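(* Consider the Minimax problem of minimizing $f(x)=h(F(x))$ over $x\in\Omega$, where $h(z)=\max_{i=1,\ldots,m}z_i$ for $z\in\mathbb{R}^m$. Suppose that: $\Omega\subset\mathbb{R}^n$ is nonempty, closed and convex; $F:\mathbb{R}^n\to\mathbb{R}^m$ is differentiable with $\|J_F(x)-J_F(y)\|_2\le L_J\|x-y\|_2$ for all $x,y\in\mathbb{R}^n$; each component $F_i$ is convex; there is $f_{low}\in\mathbb{R}$ with $f(x)\ge f_{low}$ for all $x\in\mathbb{R}^n$; $f$ has a global minimizer $x^*$ on $\Omega$; and $D_0:=\sup\{\|x-x^*\|_p: x\in\Omega,\ f(x)\le f(x_0)\}<+\infty$. Given $\epsilon_f>0$, let the algorithm TRFD (described in the context) be run with the $p$-norm, with $\Delta_*\ge D_0$ and with $\epsilon=\epsilon_f/\Delta_*$. Then the number of evaluations of $F$ that TRFD needs to find $x_k$ such that $f(x_k)-f(x^* )\le\epsilon_f$ is no more than - $\mathcal{O}\left(n\sqrt{m}\,L_J\Delta_*^2\epsilon_f^{-1}\right)$ if $p=1$ (with $L_{h,1}=1$, $c_{1,2}(m)=\sqrt m$, $c_{2,1}(n)=1$); - $\mathcal{O}\left(n\,L_J\Delta_*^2\epsilon_f^{-1}\right)$ if $p=2$ (with $L_{h,2}=1$, $c_{2,2}(m)=1$, $c_{2,2}(n)=1$); - $\mathcal{O}\left(n^2L_J\Delta_*^2\epsilon_f^{-1}\right)$ if $p=\infty$ (with $L_{h,\infty}=1$, $c_{\infty,2}(m)=1$, $c_{2,\infty}(n)=\sqrt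 n$). In particular, for Minimax problems with convex components, the bound reduces to $\mathcal{O}(n\epsilon_f^{-1})$ when $p=1$ or $p=2$ is used in TRFD.
   Context: Notation: $\|\cdot\|_p$ is the $p$-norm (for matrices, $\|\cdot\|_2$ is the spectral norm), $J_F$ is the Jacobian of $F$, $\Omega-\{x\}=\{s\in\mathbb{R}^n:x+s\in\Omega\}$, $[A]_j$ is the $j$-th column of $A$, $e_j$ is the $j$-th canonical vector. The constants $c_{2,p}(n),c_{p,2}(m)\ge1$ satisfy $\|x\|_2\le c_{2,p}(n)\|x\|_p$ on $\mathbb{R}^n$ and $\|z\|_p\le c_{p,2}(m)\|z\|_2$ on $\mathbb{R}^m$; $L_{h,p}$ satisfies $|h(z)-h(w)|\le L_{h,p}\|z-w\|_p$ on $\mathbb{R}^m$. For $r>0$, $x\in\Omega$, $A\in\mathbb{R}^{m\times n}$, $$\eta_{p,r}(x;A)=\tfrac1r\Big(h(F(x))-\min_{s\in\Omega-\{x\},\,\|s\|_p\le r}h(F(x)+As)\Big).$$ Algorithm TRFD. Step 0: given $x_0\in\Omega$, $\epsilon>0$, $\sigma>0$, $\alpha\in(0,1)$, $\theta\in(0,1]$ and $L_{h,p}$, set $\tau_0=\epsilon/(L_{h,p}\sigma c_{p,2}(m)c_{2,p}(n)\sqrt n)$, choose $\Delta_0,\Delta_*$ with $\tau_0\sqrt n\le\Delta_0\le\Delta_*$, set $k:=0$. Step 1: construct $A_k\in\mathbb{R}^{m\times n}$ with $[A_k]_j=(F(x_k+\tau_ke_j)-F(x_k))/\tau_k$, $j=1,\ldots,n$,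 and compute $\eta_{p,\Delta_*}(x_k;A_k)$. Step 2: if $\eta_{p,\Delta_*}(x_k;A_k)\ge\epsilon/2$ go to Step 3; otherwise set $x_{k+1}=x_k$, $\Delta_{k+1}=\Delta_k$, $\tau_{k+1}=\frac12\tau_k$, $k:=k+1$ and go to Step 1. Step 3: let $d_k^*$ minimize $h(F(x_k)+A_kd)$ subject to $\|d\|_p\le\Delta_k$, $x_k+d\in\Omega$; compute $d_k$ with $\|d_k\|_p\le\Delta_k$, $x_k+d_k\in\Omega$ and $h(F(x_k))-h(F(x_k)+A_kd_k)\ge\theta[h(F(x_k))-h(F(x_k)+A_kd_k^* )]$. Step 4: compute $\rho_k=\frac{h(F(x_k))-h(F(x_k+d_k))}{h(F(x_k))-h(F(x_k)+A_kd_k)}$; if $\rho_k\ge\alpha$, set $x_{k+1}=x_k+d_k$, $\Delta_{k+1}=\min\{2\Delta_k,\Delta_*\}$, $\tau_{k+1}=\tau_k$, $k:=k+1$ and go to Step 1. Step 5 (if $\rho_k<\alpha$): set $x_{k+1}=x_k$, $\Delta_{k+1}=\frac12\Delta_k$; if $\tau_k\sqrt n\le\Delta_{k+1}$, set $\tau_{k+1}=\tau_k$, $A_{k+1}=A_k$, $k:=k+1$ and go to Step 3; otherwise set $\tau_{k+1}=\frac12\tau_k$, $k:=k+1$ and go to Step 1. There is no stopping test. Meaning of the big-O: the bounds are the leading term of the following explicit bound, in which each iteration is counted as at most $n+1$ evaluations of $F$ and the iterations counted are those before the first $k$ with $f(x_k)-f(x^* )\le\Delta_*\epsilon$ (here $\Delta_*\epsilon=\epsilon_f$):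 $$(n+1)\Big[2\Big(1+\tfrac{(L_J/\sigma+1)\beta}{\alpha\theta}\epsilon^{-1}\Big)+\Big\lceil\Big|\log_2\tfrac{4\max\{\sigma,L_J\}c_{2,p}(n)}{\sigma(1-\alpha)\theta}\Big|\Big\rceil+\log_2\Big(\tfrac{4L_{h,p}\max\{\sigma,L_J\}c_{p,2}(m)c_{2,p}(n)^2\Delta_0}{(1-\alpha)\theta}\epsilon^{-1}\Big)\Big],$$ $$\beta=\max\Big\{\tfrac{f(x_0)-f(x^* )}{\Delta_0},\ \tfrac{2(L_J/\sigma+1)\Delta_*L_{h,p}L_Jc_{p,2}(m)c_{2,p}(n)^2}{(1-\alpha)\theta}\Big\}.$$ This gives the general form $\mathcal{O}(n\,c_{2,p}(n)^2c_{p,2}(m)L_{h,p}L_J\Delta_*^2\epsilon_f^{-1})$, where the big-O displays only the dependence on these quantities (the algorithmic parameters $\alpha,\theta$, the factors $L_J/\sigma+1$ and the first term in the maximum defining $\beta$ are suppressed). In the final $\mathcal{O}(n\epsilon_f^{-1})$, the dependence on $m$, $L_J$ and $\Delta_*$ is suppressed as well. *)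

theory Defs
  imports "HOL-Analysis.Analysis"
begin

definition pnorm :: "ereal \<Rightarrow> real ^ 'n \<Rightarrow> real" where
  "pnorm p x =
     (if p = \<infinity> then Max (range (\<lambda>i. \<bar>x $ i\<bar>))
      else (\<Sum>i\<in>UNIV. \<bar>x $ i\<bar> powr real_of_ereal p) powr (1 / real_of_ereal p))"

definition vmax :: "real ^ 'm \<Rightarrow> real" where
  "vmax z = Max (range (\<lambda>i. z $ i))"

definition steps :: "ereal \<Rightarrow> (real ^ 'n) set \<Rightarrow> real ^ 'n \<Rightarrow> real \<Rightarrow> (real ^ 'n) set" where
  "steps p \<Omega> x r = {s. x + s \<in> \<Omega> \<and> pnorm p s \<le> r}"

text \<open>For closed \<open>\<Omega>\<close>, \<open>x \<in> \<Omega>\<close> and continuous \<open>h\<close> the set of steps is compact and nonempty,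
  so the infimum below is a minimum.\<close>

definition eta ::
  "ereal \<Rightarrow> (real ^ 'n) set \<Rightarrow> (real ^ 'm \<Rightarrow> real) \<Rightarrow> (real ^ 'n \<Rightarrow> real ^ 'm)
     \<Rightarrow> real \<Rightarrow> real ^ 'n \<Rightarrow> real ^ 'n ^ 'm \<Rightarrow> real" where
  "eta p \<Omega> h F r x A =
     1 / r * (h (F x) - (INF s \<in> steps p \<Omega> x r. h (F x + A *v s)))"

definition forward_difference ::
  "(real ^ 'n \<Rightarrow> real ^ 'm) \<Rightarrow> real ^ 'n \<Rightarrow> real \<Rightarrow> real ^ 'n ^ 'm \<Rightarrow> bool" where
  "forward_difference F x \<tau> A \<longleftrightarrow>
     (\<forall>j. column j A = (1 / \<tau>) *\<^sub>R (F (x + \<tau> *\<^sub>R axis j 1) - F x))"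

text \<open>The quantities attached to one iteration. The flag \<open>at_step1\<close> tells whether the iteration
  starts at Step 1 (a new matrix is built and \<open>eta\<close> is tested) or directly at Step 3 (the matrix
  of the previous iteration is reused). The two step components are irrelevant in an iteration
  that does not reach Step 3.\<close>

record ('n, 'm) iterate =
  point :: "real ^ 'n"
  radius :: real
  fd_size :: real
  model :: "real ^ 'n ^ 'm"
  exact_step :: "real ^ 'n"
  trial_step :: "real ^ 'n"
  at_step1 :: bool

definition model_decrease ::
  "(real ^ 'm \<Rightarrow> real) \<Rightarrow> (real ^ 'n \<Rightarrow> real ^ 'm) \<Rightarrow> ('n, 'm) iterate \<Rightarrow> real ^ 'n \<Rightarrow> real" where
  "model_decrease h F s d = h (F (point s)) - h (F (point s) + model s *v d)"

definition reaches_step3 ::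
  "ereal \<Rightarrow> (real ^ 'n) set \<Rightarrow> (real ^ 'm \<Rightarrow> real) \<Rightarrow> (real ^ 'n \<Rightarrow> real ^ 'm)
     \<Rightarrow> real \<Rightarrow> real \<Rightarrow> ('n, 'm) iterate \<Rightarrow> bool" where
  "reaches_step3 p \<Omega> h F \<epsilon> \<Delta>\<^sub>m\<^sub>a\<^sub>x s \<longleftrightarrow>
     (at_step1 s \<longrightarrow> eta p \<Omega> h F \<Delta>\<^sub>m\<^sub>a\<^sub>x (point s) (model s) \<ge> \<epsilon> / 2)"

definition admissible_trial ::
  "ereal \<Rightarrow> (real ^ 'n) set \<Rightarrow> (real ^ 'm \<Rightarrow> real) \<Rightarrow> (real ^ 'n \<Rightarrow> real ^ 'm)
     \<Rightarrow> real \<Rightarrow> ('n, 'm) iterate \<Rightarrow> bool" where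
  "admissible_trial p \<Omega> h F \<theta> s \<longleftrightarrow>
     is_arg_min (\<lambda>d. h (F (point s) + model s *v d))
       (\<lambda>d. d \<in> steps p \<Omega> (point s) (radius s)) (exact_step s) \<and>
     trial_step s \<in> steps p \<Omega> (point s) (radius s) \<and>
     model_decrease h F s (trial_step s) \<ge> \<theta> * model_decrease h F s (exact_step s)"

definition rho ::
  "(real ^ 'm \<Rightarrow> real) \<Rightarrow> (real ^ 'n \<Rightarrow> real ^ 'm) \<Rightarrow> ('n, 'm) iterate \<Rightarrow> real" where
  "rho h F s =
     (h (F (point s)) - h (F (point s + trial_step s))) / model_decrease h F s (trial_step s)"

definition trfd_iteration ::
  "ereal \<Rightarrow> (real ^ 'n) set \<Rightarrow> (real ^ 'm \<Rightarrow> real) \<Rightarrow> (real ^ 'n \<Rightarrow> real ^ 'm)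
     \<Rightarrow> real \<Rightarrow> real \<Rightarrow> real \<Rightarrow> real
     \<Rightarrow> ('n, 'm) iterate \<Rightarrow> ('n, 'm) iterate \<Rightarrow> bool" where
  "trfd_iteration p \<Omega> h F \<epsilon> \<alpha> \<theta> \<Delta>\<^sub>m\<^sub>a\<^sub>x s s' \<longleftrightarrow>
     (at_step1 s \<longrightarrow> forward_difference F (point s) (fd_size s) (model s)) \<and>
     (if \<not> reaches_step3 p \<Omega> h F \<epsilon> \<Delta>\<^sub>m\<^sub>a\<^sub>x s then
        point s' = point s \<and> radius s' = radius s \<and> fd_size s' = fd_size s / 2 \<and> at_step1 s'
      else
        admissible_trial p \<Omega> h F \<theta> s \<and>
        (if rho h F s \<ge> \<alpha> then
           point s' = point s + trial_step s \<and> radius s' = min (2 * radius s) \<Delta>\<^sub>m\<^sub>a\<^sub>x \<and>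
           fd_size s' = fd_size s \<and> at_step1 s'
         else
           point s' = point s \<and> radius s' = radius s / 2 \<and>
           (if fd_size s * sqrt (real CARD('n)) \<le> radius s' then
              fd_size s' = fd_size s \<and> model s' = model s \<and> \<not> at_step1 s'
            else
              fd_size s' = fd_size s / 2 \<and> at_step1 s')))"

text \<open>\<open>T k\<close> is the \<open>k\<close>-th iterate. Runs are infinite, as there is no stopping test.\<close>

definition trfd_run ::
  "ereal \<Rightarrow> real \<Rightarrow> real \<Rightarrow> real
     \<Rightarrow> (real ^ 'n) set \<Rightarrow> (real ^ 'm \<Rightarrow> real) \<Rightarrow> (real ^ 'n \<Rightarrow> real ^ 'm)
     \<Rightarrow> real ^ 'n \<Rightarrow> real \<Rightarrow> real \<Rightarrow> real \<Rightarrow> real \<Rightarrow> real \<Rightarrow> real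
     \<Rightarrow> (nat \<Rightarrow> ('n, 'm) iterate) \<Rightarrow> bool" where
  "trfd_run p Lh cp2 c2p \<Omega> h F x\<^sub>0 \<epsilon> \<sigma> \<alpha> \<theta> \<Delta>\<^sub>0 \<Delta>\<^sub>m\<^sub>a\<^sub>x T \<longleftrightarrow>
     x\<^sub>0 \<in> \<Omega> \<and> 0 < \<epsilon> \<and> 0 < \<sigma> \<and> 0 < \<alpha> \<and> \<alpha> < 1 \<and> 0 < \<theta> \<and> \<theta> \<le> 1 \<and>
     point (T 0) = x\<^sub>0 \<and> radius (T 0) = \<Delta>\<^sub>0 \<and> at_step1 (T 0) \<and>
     fd_size (T 0) = \<epsilon> / (Lh * \<sigma> * cp2 * c2p * sqrt (real CARD('n))) \<and>
     fd_size (T 0) * sqrt (real CARD('n)) \<le> \<Delta>\<^sub>0 \<and> \<Delta>\<^sub>0 \<le> \<Delta>\<^sub>m\<^sub>a\<^sub>x \<and>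
     (\<forall>k. trfd_iteration p \<Omega> h F \<epsilon> \<alpha> \<theta> \<Delta>\<^sub>m\<^sub>a\<^sub>x (T k) (T (Suc k)))"

text \<open>Number of evaluations of \<open>F\<close> in one iteration: the \<open>n\<close> perturbed points of Step 1 and the
  trial point of Step 4, hence at most \<open>n + 1\<close>; the value of \<open>F\<close> at the current point is known
  from an earlier iteration. Only the value at the starting point has to be added.\<close>

definition iteration_evals ::
  "ereal \<Rightarrow> (real ^ 'n) set \<Rightarrow> (real ^ 'm \<Rightarrow> real) \<Rightarrow> (real ^ 'n \<Rightarrow> real ^ 'm)
     \<Rightarrow> real \<Rightarrow> real \<Rightarrow> ('n, 'm) iterate \<Rightarrow> nat" where
  "iteration_evals p \<Omega> h F \<epsilon> \<Delta>\<^sub>m\<^sub>a\<^sub>x s =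
     (if at_step1 s then CARD('n) else 0) + (if reaches_step3 p \<Omega> h F \<epsilon> \<Delta>\<^sub>m\<^sub>a\<^sub>x s then 1 else 0)"

definition evals_before ::
  "ereal \<Rightarrow> (real ^ 'n) set \<Rightarrow> (real ^ 'm \<Rightarrow> real) \<Rightarrow> (real ^ 'n \<Rightarrow> real ^ 'm)
     \<Rightarrow> real \<Rightarrow> real \<Rightarrow> (nat \<Rightarrow> ('n, 'm) iterate) \<Rightarrow> nat \<Rightarrow> nat" where
  "evals_before p \<Omega> h F \<epsilon> \<Delta>\<^sub>m\<^sub>a\<^sub>x T K = 1 + (\<Sum>k<K. iteration_evals p \<Omega> h F \<epsilon> \<Delta>\<^sub>m\<^sub>a\<^sub>x (T k))"

text \<open>The explicit complexity bound; \<open>gap\<close> is the initial gap between the value at the starting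
  point and the minimal value.\<close>

definition beta :: "real \<Rightarrow> real \<Rightarrow> real \<Rightarrow> real \<Rightarrow> real \<Rightarrow> real \<Rightarrow> real \<Rightarrow> real \<Rightarrow> real \<Rightarrow> real \<Rightarrow> real"
  where
  "beta Lh cp2 c2p L\<^sub>J \<sigma> \<alpha> \<theta> \<Delta>\<^sub>0 \<Delta>\<^sub>m\<^sub>a\<^sub>x gap =
     max (gap / \<Delta>\<^sub>0)
         (2 * (L\<^sub>J / \<sigma> + 1) * \<Delta>\<^sub>m\<^sub>a\<^sub>x * Lh * L\<^sub>J * cp2 * c2p\<^sup>2 / ((1 - \<alpha>) * \<theta>))"

definition trfd_bound ::
  "nat \<Rightarrow> real \<Rightarrow> real \<Rightarrow> real \<Rightarrow> real \<Rightarrow> real \<Rightarrow> real \<Rightarrow> real \<Rightarrow> real \<Rightarrow> real \<Rightarrow> real \<Rightarrow> real \<Rightarrow> real" where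
  "trfd_bound n Lh cp2 c2p L\<^sub>J \<sigma> \<alpha> \<theta> \<Delta>\<^sub>0 \<Delta>\<^sub>m\<^sub>a\<^sub>x gap \<epsilon> =
     (real n + 1) *
       (2 * (1 + (L\<^sub>J / \<sigma> + 1) * beta Lh cp2 c2p L\<^sub>J \<sigma> \<alpha> \<theta> \<Delta>\<^sub>0 \<Delta>\<^sub>m\<^sub>a\<^sub>x gap / (\<alpha> * \<theta>) * inverse \<epsilon>)
        + real_of_int \<lceil>\<bar>log 2 (4 * max \<sigma> L\<^sub>J * c2p / (\<sigma> * (1 - \<alpha>) * \<theta>))\<bar>\<rceil>
        + log 2 (4 * Lh * max \<sigma> L\<^sub>J * cp2 * c2p\<^sup>2 * \<Delta>\<^sub>0 / ((1 - \<alpha>) * \<theta>) * inverse \<epsilon>))"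

text \<open>Scope of the big-O. The parameter \<open>\<kappa>\<close> bounds the suppressed quantities: \<open>\<sigma>\<close> and \<open>L\<^sub>J\<close> are
  comparable, the first term in the maximum defining \<open>beta\<close> does not dominate the second one, and
  the accuracy \<open>\<epsilon>\<^sub>f\<close> is small enough for the additive constants and the logarithms to be of lower
  order. For \<open>L\<^sub>J > 0\<close>, any given instance is in this range for some \<open>\<kappa>\<close>, and then
  so it is with every smaller \<open>\<epsilon>\<^sub>f\<close>.\<close>

definition leading_range ::
  "real \<Rightarrow> real \<Rightarrow> real \<Rightarrow> real \<Rightarrow> real \<Rightarrow> real \<Rightarrow> real \<Rightarrow> real \<Rightarrow> real \<Rightarrow> real \<Rightarrow> bool" where
  "leading_range \<kappa> Lh cp2 c2p L\<^sub>J \<sigma> \<Delta>\<^sub>0 \<Delta>\<^sub>m\<^sub>a\<^sub>x gap \<epsilon>\<^sub>f \<longleftrightarrow>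
     1 \<le> \<kappa> \<and> L\<^sub>J \<le> \<kappa> * \<sigma> \<and> \<sigma> \<le> \<kappa> * L\<^sub>J \<and>
     gap / \<Delta>\<^sub>0 \<le> \<kappa> * (\<Delta>\<^sub>m\<^sub>a\<^sub>x * Lh * L\<^sub>J * cp2 * c2p\<^sup>2) \<and>
     \<epsilon>\<^sub>f \<le> \<kappa> * (L\<^sub>J * \<Delta>\<^sub>m\<^sub>a\<^sub>x\<^sup>2)"

text \<open>The implied constant. It does not depend on the dimensions (which are types, so that the
  constant cannot be existentially quantified uniformly in them), nor on \<open>L\<^sub>J\<close>, the radii and
  the accuracy. It is the factor \<open>(L\<^sub>J/\<sigma> + 1)\<^sup>2 / (\<alpha>(1 - \<alpha>)\<theta>\<^sup>2)\<close> of the leading term of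
  \<open>trfd_bound\<close>, up to a numerical factor that absorbs the remaining terms.\<close>

definition bigO_const :: "real \<Rightarrow> real \<Rightarrow> real \<Rightarrow> real" where
  "bigO_const \<kappa> \<alpha> \<theta> = 60 * \<kappa>\<^sup>2 / (\<alpha> * (1 - \<alpha>) * \<theta>\<^sup>2)"

text \<open>The constant for the final form, in which only the dimension \<open>n\<close> and the accuracy are displayed
  and everything else is held fixed, for accuracies up to \<open>E\<close>; here \<open>Lh = c2p = 1\<close>.\<close>

definition bigO_const_fixed ::
  "real \<Rightarrow> real \<Rightarrow> real \<Rightarrow> real \<Rightarrow> real \<Rightarrow> real \<Rightarrow> real \<Rightarrow> real \<Rightarrow> real \<Rightarrow> real" where
  "bigO_const_fixed cp2 L\<^sub>J \<sigma> \<alpha> \<theta> \<Delta>\<^sub>0 \<Delta>\<^sub>m\<^sub>a\<^sub>x gap E =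
     2 * (E * (2 + real_of_int \<lceil>\<bar>log 2 (4 * max \<sigma> L\<^sub>J / (\<sigma> * (1 - \<alpha>) * \<theta>))\<bar>\<rceil>)
          + 2 * (L\<^sub>J / \<sigma> + 1) * beta 1 cp2 1 L\<^sub>J \<sigma> \<alpha> \<theta> \<Delta>\<^sub>0 \<Delta>\<^sub>m\<^sub>a\<^sub>x gap * \<Delta>\<^sub>m\<^sub>a\<^sub>x / (\<alpha> * \<theta>)
          + 4 * max \<sigma> L\<^sub>J * cp2 * \<Delta>\<^sub>0 * \<Delta>\<^sub>m\<^sub>a\<^sub>x / ((1 - \<alpha>) * \<theta>))"

end

theory Submission
  imports Defs
begin

text \<open>Write \<open>\<delta>\<^sub>k\<close> for the gap \<open>f x\<^sub>k - f x\<^sub>s\<close> and \<open>\<eta>\<^sub>k\<close> for the criticality measure at the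
  finite-difference model. By convexity of the components and monotonicity of the maximum, the step
  \<open>x\<^sub>s - x\<^sub>k\<close> makes the measure at the exact Jacobian at least \<open>\<delta>\<^sub>k / \<Delta>\<^sub>m\<^sub>a\<^sub>x\<close>, so \<open>\<eta>\<^sub>k\<close> dominates a
  multiple of \<open>\<delta>\<^sub>k\<close> whenever the model is accepted. Taylor's formula shows that a step can only fail
  when the radius is at least a multiple of \<open>\<eta>\<^sub>k\<close>; hence the radius stays above \<open>\<delta>\<^sub>k / \<beta>\<close> and also
  above a fixed multiple of \<open>\<epsilon>\<close>. A successful step therefore decreases the gap by a multiple of
  \<open>\<delta>\<^sub>k\<^sup>2\<close>, that is, \<open>1 / \<delta>\<^sub>k\<close> grows by a constant; this bounds the number of successes. Failures halve
  and successes at most double the radius, so its lower bound limits the failures, and a model is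
  only refused while the finite-difference size exceeds a fixed multiple of its initial value.\<close>

section \<open>The norms and the maximum function\<close>

lemma pnorm_zero: "pnorm p 0 = 0"
  by (simp add: pnorm_def)

lemma pnorm_minus: "pnorm p (- x) = pnorm p x"
  by (simp add: pnorm_def)

text \<open>Homogeneity is what lets a step be shrunk to fit a smaller radius.\<close>

lemma pnorm_scaleR:
  assumes "p = \<infinity> \<or> 0 < real_of_ereal p" and "0 \<le> t"
  shows "pnorm p (t *\<^sub>R x) = t * pnorm p x"
proof (cases "p = \<infinity>")
  case True
  have "Max ((*) t ` range (\<lambda>i. \<bar>x $ i\<bar>)) = t * Max (range (\<lambda>i. \<bar>x $ i\<bar>))"
    using assms(2) by (intro mono_Max_commute[symmetric] monoI) (auto intro: mult_left_mono)
  then show ?thesis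
    using True assms(2) by (simp add: pnorm_def image_image abs_mult)
next
  case False
  then have q: "0 < real_of_ereal p" using assms(1) by auto
  have "pnorm p (t *\<^sub>R x) = (t powr real_of_ereal p *
      (\<Sum>i\<in>UNIV. \<bar>x $ i\<bar> powr real_of_ereal p)) powr (1 / real_of_ereal p)"
    using False assms(2) by (simp add: pnorm_def abs_mult powr_mult sum_distrib_left)
  also have "\<dots> = t * pnorm p x"
    using False q assms(2)
    by (simp add: pnorm_def powr_mult powr_powr sum_nonneg)
  finally show ?thesis .
qed

lemma norm_le_pnorm_1: "norm x \<le> pnorm 1 x"
  using norm_le_l1_cart[of x] by (simp add: pnorm_def sum_nonneg)

lemma norm_eq_pnorm_2: "norm x = pnorm 2 x"
  by (simp add: pnorm_def norm_vec_def L2_set_def powr_half_sqrt sum_nonneg)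

text \<open>Replacing every component by the largest absolute value can only increase the Euclidean
  norm; the constant vector obtained supplies the square root of the dimension.\<close>

lemma norm_le_pnorm_infinity: "norm (x :: real ^ 'n) \<le> sqrt (real CARD('n)) * pnorm \<infinity> x"
proof -
  have "norm x \<le> L2_set (\<lambda>i::'n. pnorm \<infinity> x) UNIV"
    unfolding norm_vec_def by (intro L2_set_mono) (auto simp: pnorm_def)
  also have "\<dots> = sqrt (real CARD('n)) * \<bar>pnorm \<infinity> x\<bar>"
    by (simp add: L2_set_def real_sqrt_mult)
  also have "\<bar>pnorm \<infinity> x\<bar> = pnorm \<infinity> x"
    by (auto simp: pnorm_def Max_ge_iff)
  finally show ?thesis .
qed

lemma vmax_ge: "z $ i \<le> vmax z"
  unfolding vmax_def by (intro Max_ge) auto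

lemma vmax_le: "(\<And>i. z $ i \<le> b) \<Longrightarrow> vmax z \<le> b"
  unfolding vmax_def by (subst Max_le_iff) auto

lemma vmax_mono: "(\<And>i. z $ i \<le> w $ i) \<Longrightarrow> vmax z \<le> vmax w"
  by (meson order_trans vmax_ge vmax_le)

text \<open>No component of \<open>z\<close> exceeds the same component of \<open>w\<close> by more
  than the norm of the difference. Maxima preserve this, and exchanging \<open>z\<close> and
  \<open>w\<close> gives the other sign.\<close>

lemma vmax_lipschitz: "\<bar>vmax z - vmax w\<bar> \<le> norm (z - w)"
proof -
  have "vmax z - vmax w \<le> norm (z - w)" for z w :: "real ^ 'm"
  proof -
    have "z $ i \<le> vmax w + norm (z - w)" for i
      using vmax_ge[of w i] component_le_norm_cart[of "z - w" i] by simp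
    then show ?thesis using vmax_le[of z] by fastforce
  qed
  from this[of z w] this[of w z] show ?thesis by (simp add: norm_minus_commute)
qed

lemma convex_on_vmax: "convex_on UNIV vmax"
proof (intro convex_onI vmax_le)
  fix t :: real and z w :: "real ^ 'm" and i
  assume "0 < t" "t < 1"
  then show "((1 - t) *\<^sub>R z + t *\<^sub>R w) $ i \<le> (1 - t) * vmax z + t * vmax w"
    by (auto intro!: add_mono mult_left_mono vmax_ge)
qed auto

section \<open>Smoothness and convexity\<close>

text \<open>For two points at distance 1, the right-hand side is \<open>L\<close> itself and the
  left-hand side is an operator norm.\<close>

lemma lipschitz_constant_nonneg:
  fixes G :: "real ^ 'n \<Rightarrow> real ^ 'n ^ 'm"
  assumes "\<And>x y. onorm ((*v) (G x - G y)) \<le> L * norm (x - y)"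
  shows "0 \<le> L"
proof -
  have "0 \<le> onorm ((*v) (G (axis undefined 1) - G 0))"
    by (intro onorm_pos_le matrix_vector_mul_bounded_linear)
  also have "\<dots> \<le> L * norm (axis (undefined::'n) (1::real) - 0)" by (rule assms)
  finally show ?thesis by simp
qed

text \<open>Along the segment from \<open>x\<close> to \<open>x + v\<close> the remainder has
  derivative \<open>(?J (x + t *\<^sub>R v) - ?J x) *v v\<close>, of norm at most
  \<open>L * (norm v)\<^sup>2 * t\<close>. Integrating over the unit interval produces the factor
  1/2.\<close>

lemma jacobian_taylor:
  fixes F :: "real ^ 'n \<Rightarrow> real ^ 'm"
  assumes diff: "\<And>x. F differentiable (at x)"
    and lip: "\<And>x y. onorm ((*v) (jacobian F (at x) - jacobian F (at y))) \<le> L * norm (x - y)"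
  shows "norm (F (x + v) - F x - jacobian F (at x) *v v) \<le> L / 2 * (norm v)\<^sup>2"
proof -
  let ?J = "\<lambda>x. jacobian F (at x)"
  let ?\<phi> = "\<lambda>t. F (x + t *\<^sub>R v) - t *\<^sub>R (?J x *v v)"
  let ?\<psi> = "\<lambda>t. L * (norm v)\<^sup>2 * t\<^sup>2 / 2"
  have F': "(F has_derivative (\<lambda>h. ?J x *v h)) (at x)" for x
    using diff jacobian_works by blast
  have \<phi>': "(?\<phi> has_vector_derivative ((?J (x + t *\<^sub>R v) - ?J x) *v v)) (at t)" for t
  proof -
    have "((\<lambda>t. x + t *\<^sub>R v) has_derivative (\<lambda>h. h *\<^sub>R v)) (at t)"
      by (auto intro!: derivative_eq_intros)
    then have "((\<lambda>t. F (x + t *\<^sub>R v)) has_derivative (\<lambda>h. ?J (x + t *\<^sub>R v) *v (h *\<^sub>R v))) (at t)"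
      by (rule has_derivative_compose) (rule F')
    then have "((\<lambda>t. F (x + t *\<^sub>R v)) has_vector_derivative ?J (x + t *\<^sub>R v) *v v) (at t)"
      by (simp add: has_vector_derivative_def matrix_vector_mult_scaleR)
    then show ?thesis
      by (auto intro!: derivative_eq_intros simp: matrix_vector_mult_diff_rdistrib)
  qed
  have \<psi>': "(?\<psi> has_vector_derivative (L * (norm v)\<^sup>2 * t)) (at t)" for t
    unfolding has_real_derivative_iff_has_vector_derivative[symmetric]
    by (auto intro!: derivative_eq_intros)
  have bound: "norm ((?J (x + t *\<^sub>R v) - ?J x) *v v) \<le> L * (norm v)\<^sup>2 * t" if "0 < t" for t
  proof -
    have "norm ((?J (x + t *\<^sub>R v) - ?J x) *v v) \<le> onorm ((*v) (?J (x + t *\<^sub>R v) - ?J x)) * norm v"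
      by (intro onorm matrix_vector_mul_bounded_linear)
    also have "\<dots> \<le> (L * norm ((x + t *\<^sub>R v) - x)) * norm v"
      by (intro mult_right_mono lip) auto
    finally show ?thesis using that by (simp add: power2_eq_square algebra_simps)
  qed
  \<comment> \<open>The mean value inequality compares \<open>?\<phi>\<close> with the
    antiderivative \<open>?\<psi>\<close> of the bound, so no integral has to be formed.\<close>
  have "norm (?\<phi> 1 - ?\<phi> 0) \<le> ?\<psi> 1 - ?\<psi> 0"
    by (rule differentiable_bound_general[where f' = "\<lambda>t. (?J (x + t *\<^sub>R v) - ?J x) *v v"
          and \<phi>' = "\<lambda>t. L * (norm v)\<^sup>2 * t"])
      (use \<phi>' \<psi>' bound in \<open>auto intro!: continuous_at_imp_continuous_on
          dest: has_vector_derivative_continuous\<close>)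
  then show ?thesis by (simp add: algebra_simps)
qed

text \<open>Taylor's formula with the step \<open>\<tau> *\<^sub>R axis j 1\<close> bounds the error
  of each column by \<open>L * \<tau> / 2\<close>. Summing over the columns leaves the 1-norm of
  \<open>s\<close>, which costs a square root of the dimension.\<close>

lemma forward_difference_error:
  fixes F :: "real ^ 'n \<Rightarrow> real ^ 'm"
  assumes diff: "\<And>x. F differentiable (at x)"
    and lip: "\<And>x y. onorm ((*v) (jacobian F (at x) - jacobian F (at y))) \<le> L * norm (x - y)"
    and fd: "forward_difference F x \<tau> A" and "0 < \<tau>"
  shows "norm (A *v s - jacobian F (at x) *v s) \<le> L * sqrt (real CARD('n)) * \<tau> / 2 * norm s"
proof -
  let ?J = "jacobian F (at x)"
  have L: "0 \<le> L" using lip by (rule lipschitz_constant_nonneg)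
  have col: "norm (column j (A - ?J)) \<le> L * \<tau> / 2" for j
  proof -
    have "column j (A - ?J) = column j A - ?J *v axis j 1"
      by (simp add: column_def vec_eq_iff matrix_vector_mul_component inner_axis)
    also have "\<dots> = (1 / \<tau>) *\<^sub>R (F (x + \<tau> *\<^sub>R axis j 1) - F x - ?J *v (\<tau> *\<^sub>R axis j 1))"
      using fd \<open>0 < \<tau>\<close>
      by (simp add: forward_difference_def matrix_vector_mult_scaleR algebra_simps)
    also have "norm \<dots> \<le> (1 / \<tau>) * (L / 2 * (norm (\<tau> *\<^sub>R axis j (1::real)))\<^sup>2)"
      using mult_left_mono[OF jacobian_taylor[OF diff lip, of x "\<tau> *\<^sub>R axis j 1"], of "1 / \<tau>"]
        \<open>0 < \<tau>\<close> by simp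
    finally show ?thesis using \<open>0 < \<tau>\<close> by (simp add: power2_eq_square)
  qed
  \<comment> \<open>Cauchy-Schwarz against the vector with all entries 1.\<close>
  have l1: "(\<Sum>j\<in>UNIV. \<bar>s $ j\<bar>) \<le> sqrt (real CARD('n)) * norm s"
    using L2_set_mult_ineq[of "\<lambda>j. \<bar>s $ j\<bar>" "\<lambda>j. 1" UNIV]
    by (simp add: norm_vec_def L2_set_def mult.commute)
  have "A *v s - ?J *v s = (\<Sum>j\<in>UNIV. s $ j *\<^sub>R column j (A - ?J))"
    unfolding matrix_vector_mult_diff_rdistrib[symmetric]
    by (simp add: matrix_mult_sum scalar_mult_eq_scaleR)
  also have "norm \<dots> \<le> (\<Sum>j\<in>UNIV. \<bar>s $ j\<bar> * (L * \<tau> / 2))"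
    by (intro sum_norm_le) (use col in \<open>auto intro: mult_left_mono simp del: times_divide_eq_right\<close>)
  also have "\<dots> \<le> (sqrt (real CARD('n)) * norm s) * (L * \<tau> / 2)"
    unfolding sum_distrib_right[symmetric] using L \<open>0 < \<tau>\<close>
    by (intro mult_right_mono l1) auto
  finally show ?thesis by (simp add: algebra_simps)
qed

text \<open>On the line through \<open>x\<close> in direction \<open>s\<close> the component is a
  convex function of one variable; it lies above its tangent at 0, here evaluated at 1.\<close>

lemma convex_above_jacobian:
  fixes F :: "real ^ 'n \<Rightarrow> real ^ 'm"
  assumes diff: "F differentiable (at x)" and convex: "convex_on UNIV (\<lambda>x. F x $ i)"
  shows "(F x + jacobian F (at x) *v s) $ i \<le> F (x + s) $ i"
proof -
  let ?g = "\<lambda>t. F (x + t *\<^sub>R s) $ i"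
  have "((\<lambda>t. x + t *\<^sub>R s) has_derivative (\<lambda>h. h *\<^sub>R s)) (at 0)"
    by (auto intro!: derivative_eq_intros)
  then have "((\<lambda>t. F (x + t *\<^sub>R s)) has_derivative (\<lambda>h. jacobian F (at x) *v (h *\<^sub>R s))) (at 0)"
    by (rule has_derivative_compose) (use diff jacobian_works[of F "at x"] in simp)
  then have "(?g has_derivative (\<lambda>h. (jacobian F (at x) *v (h *\<^sub>R s)) $ i)) (at 0)"
    by (rule bounded_linear.has_derivative[OF bounded_linear_vec_nth])
  then have deriv: "(?g has_real_derivative (jacobian F (at x) *v s) $ i) (at 0)"
    by (simp add: has_field_derivative_def matrix_vector_mult_scaleR mult_commute_abs)
  have "convex_on UNIV ?g"
  proof (intro convex_onI)
    fix t a b :: real assume "0 < t" "t < 1"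
    moreover have "x + ((1 - t) *\<^sub>R a + t *\<^sub>R b) *\<^sub>R s = (1 - t) *\<^sub>R (x + a *\<^sub>R s) + t *\<^sub>R (x + b *\<^sub>R s)"
      by (simp add: algebra_simps)
    ultimately show "?g ((1 - t) *\<^sub>R a + t *\<^sub>R b) \<le> (1 - t) * ?g a + t * ?g b"
      using convex_onD[OF convex, of t "x + a *\<^sub>R s" "x + b *\<^sub>R s"] by simp
  qed auto
  from convex_on_imp_above_tangent[OF this _ _ _ deriv, of 1]
  show ?thesis by simp
qed

section \<open>The criticality measure\<close>

text \<open>One admissible step bounds the infimum in \<open>eta\<close> from above, provided that
  the values are bounded below. The Lipschitz condition and the Euclidean bound on the steps ensure
  this.\<close>

lemma eta_ge:
  fixes s :: "real ^ 'n" and h :: "real ^ 'm \<Rightarrow> real"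
  assumes lip: "\<And>z w. \<bar>h z - h w\<bar> \<le> C * norm (z - w)"
    and norm_le: "\<And>s :: real ^ 'n. norm s \<le> c * pnorm p s"
    and "0 \<le> c" "0 < r" and s: "s \<in> steps p \<Omega> x r"
  shows "(h (F x) - h (F x + A *v s)) / r \<le> eta p \<Omega> h F r x A"
proof -
  have C: "0 \<le> C"
    using lip[of 0 "axis undefined 1"] by simp
  have "h (F x) - C * (onorm ((*v) A) * (c * r)) \<le> h (F x + A *v v)"
    if "v \<in> steps p \<Omega> x r" for v
  proof -
    have "norm v \<le> c * r"
      using that norm_le[of v] mult_left_mono[of "pnorm p v" r c] \<open>0 \<le> c\<close>
      by (simp add: steps_def)
    then have "norm (A *v v) \<le> onorm ((*v) A) * (c * r)"
      by (meson matrix_vector_mul_bounded_linear mult_left_mono onorm onorm_pos_le order_trans)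
    then have "C * norm (A *v v) \<le> C * (onorm ((*v) A) * (c * r))"
      using C by (rule mult_left_mono)
    with lip[of "F x" "F x + A *v v"] show ?thesis by simp
  qed
  then have "bdd_below ((\<lambda>v. h (F x + A *v v)) ` steps p \<Omega> x r)"
    by (intro bdd_belowI2)
  then have "(INF v \<in> steps p \<Omega> x r. h (F x + A *v v)) \<le> h (F x + A *v s)"
    using s by (rule cINF_lower)
  then show ?thesis using \<open>0 < r\<close> by (simp add: eta_def divide_right_mono)
qed

text \<open>A step for the radius \<open>R\<close>, scaled by \<open>t = radius s / R\<close>, fits
  the smaller radius and stays in \<open>\<Omega>\<close> by convexity. By convexity of
  \<open>h\<close> it keeps at least the fraction \<open>t\<close> of its decrease, and the
  minimizer \<open>e\<close> does no worse.\<close>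

lemma model_decrease_exact_ge:
  assumes p: "p = \<infinity> \<or> 0 < real_of_ereal p"
    and h: "convex_on UNIV h" and \<Omega>: "convex \<Omega>" "point s \<in> \<Omega>"
    and r: "0 < radius s" "radius s \<le> R"
    and min: "is_arg_min (\<lambda>d. h (F (point s) + model s *v d))
       (\<lambda>d. d \<in> steps p \<Omega> (point s) (radius s)) e"
  shows "radius s * eta p \<Omega> h F R (point s) (model s) \<le> model_decrease h F s e"
proof -
  define t where "t = radius s / R"
  have t: "0 < t" "t \<le> 1" and R: "0 < R" using r by (auto simp: t_def)
  have "h (F (point s)) - model_decrease h F s e / t \<le> h (F (point s) + model s *v v)"
    if v: "v \<in> steps p \<Omega> (point s) R" for v
  proof -
    have "point s + t *\<^sub>R v = (1 - t) *\<^sub>R point s + t *\<^sub>R (point s + v)"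
      by (simp add: algebra_simps)
    also have "\<dots> \<in> \<Omega>"
      using \<Omega> v t by (intro convexD) (auto simp: steps_def)
    finally have "t *\<^sub>R v \<in> steps p \<Omega> (point s) (radius s)"
      using v t R p mult_left_mono[of "pnorm p v" R t]
      by (auto simp: steps_def pnorm_scaleR t_def)
    then have "h (F (point s) + model s *v e) \<le> h (F (point s) + model s *v (t *\<^sub>R v))"
      using min by (auto simp: is_arg_min_linorder)
    also have "F (point s) + model s *v (t *\<^sub>R v)
        = (1 - t) *\<^sub>R F (point s) + t *\<^sub>R (F (point s) + model s *v v)"
      by (simp add: matrix_vector_mult_scaleR algebra_simps)
    also have "h \<dots> \<le> (1 - t) * h (F (point s)) + t * h (F (point s) + model s *v v)"
      using h t by (intro convex_onD) auto
    finally show ?thesis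
      using t by (simp add: model_decrease_def field_simps)
  qed
  \<comment> \<open>The zero step makes the set nonempty, as the lower bound on the infimum
    requires.\<close>
  moreover have "0 \<in> steps p \<Omega> (point s) R"
    using \<Omega> R by (simp add: steps_def pnorm_zero)
  ultimately have "h (F (point s)) - model_decrease h F s e / t
      \<le> (INF v \<in> steps p \<Omega> (point s) R. h (F (point s) + model s *v v))"
    by (intro cINF_greatest) auto
  then have "t * (h (F (point s)) - (INF v \<in> steps p \<Omega> (point s) R. h (F (point s) + model s *v v)))
      \<le> model_decrease h F s e"
    using t by (simp add: field_simps)
  then show ?thesis by (simp add: eta_def t_def)
qed

section \<open>Runs of the algorithm\<close>

text \<open>The maximum is replaced by a monotone convex \<open>h\<close> with Lipschitz constant
  \<open>Lh * cp2\<close> for the Euclidean norm. The condition on \<open>p\<close> provides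
  homogeneity of \<open>pnorm\<close>, and the bound on the level set is stated pointwise.\<close>

locale trfd =
  fixes p :: ereal and Lh cp2 c2p :: real
    and \<Omega> :: "(real ^ 'n) set" and h :: "real ^ 'm \<Rightarrow> real" and F :: "real ^ 'n \<Rightarrow> real ^ 'm"
    and x\<^sub>0 x\<^sub>s :: "real ^ 'n" and L\<^sub>J \<epsilon> \<sigma> \<alpha> \<theta> \<Delta>\<^sub>0 \<Delta>\<^sub>m\<^sub>a\<^sub>x :: real
    and T :: "nat \<Rightarrow> ('n, 'm) iterate"
  assumes p: "p = \<infinity> \<or> 0 < real_of_ereal p"
    and constants: "0 < Lh" "1 \<le> cp2" "1 \<le> c2p"
    and norm_le: "\<And>s :: real ^ 'n. norm s \<le> c2p * pnorm p s"
    and h_mono: "\<And>z w. (\<And>i. z $ i \<le> w $ i) \<Longrightarrow> h z \<le> h w"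
    and h_convex: "convex_on UNIV h"
    and h_lipschitz: "\<And>z w. \<bar>h z - h w\<bar> \<le> Lh * cp2 * norm (z - w)"
    and convex_\<Omega>: "convex \<Omega>"
    and diff: "\<And>x. F differentiable (at x)"
    and lipschitz: "\<And>x y. onorm ((*v) (jacobian F (at x) - jacobian F (at y))) \<le> L\<^sub>J * norm (x - y)"
    and convex: "\<And>i. convex_on UNIV (\<lambda>x. F x $ i)"
    and minimizer: "x\<^sub>s \<in> \<Omega>" "\<And>x. x \<in> \<Omega> \<Longrightarrow> h (F x\<^sub>s) \<le> h (F x)"
    and level_set: "\<And>x. x \<in> \<Omega> \<Longrightarrow> h (F x) \<le> h (F x\<^sub>0) \<Longrightarrow> pnorm p (x - x\<^sub>s) \<le> \<Delta>\<^sub>m\<^sub>a\<^sub>x"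
    and run: "trfd_run p Lh cp2 c2p \<Omega> h F x\<^sub>0 \<epsilon> \<sigma> \<alpha> \<theta> \<Delta>\<^sub>0 \<Delta>\<^sub>m\<^sub>a\<^sub>x T"
begin

abbreviation gap :: "nat \<Rightarrow> real" where
  "gap k \<equiv> h (F (point (T k))) - h (F x\<^sub>s)"

abbreviation crit :: "nat \<Rightarrow> real" where
  "crit k \<equiv> eta p \<Omega> h F \<Delta>\<^sub>m\<^sub>a\<^sub>x (point (T k)) (model (T k))"

text \<open>\<open>Lh * cp2\<close> turns Euclidean errors of the model into errors of
  \<open>h\<close>, and \<open>c2p\<close> turns the p-norm of a step into a Euclidean
  length.\<close>

abbreviation H :: real where
  "H \<equiv> Lh * cp2 * c2p"

lemma parameters: "0 < \<epsilon>" "0 < \<sigma>" "0 < \<alpha>" "\<alpha> < 1" "0 < \<theta>" "\<theta> \<le> 1"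
  using run by (auto simp: trfd_run_def)

lemma H_pos: "0 < H"
  using constants by auto

lemma L_nonneg: "0 \<le> L\<^sub>J"
  using lipschitz by (rule lipschitz_constant_nonneg)

lemma iteration: "trfd_iteration p \<Omega> h F \<epsilon> \<alpha> \<theta> \<Delta>\<^sub>m\<^sub>a\<^sub>x (T k) (T (Suc k))"
  using run by (auto simp: trfd_run_def)

lemma fd_size_0: "fd_size (T 0) * sqrt (real CARD('n)) * (H * \<sigma>) = \<epsilon>"
  using run H_pos parameters by (auto simp: trfd_run_def field_simps)

lemma initial: "point (T 0) = x\<^sub>0" "radius (T 0) = \<Delta>\<^sub>0"
  "fd_size (T 0) * sqrt (real CARD('n)) \<le> \<Delta>\<^sub>0" "\<Delta>\<^sub>0 \<le> \<Delta>\<^sub>m\<^sub>a\<^sub>x"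
  using run by (auto simp: trfd_run_def)

lemma \<Delta>\<^sub>0_pos: "0 < \<Delta>\<^sub>0" and fd_size_0_pos: "0 < fd_size (T 0)"
proof -
  have "0 < sqrt (real CARD('n)) * (H * \<sigma>)"
    using mult_pos_pos[OF H_pos parameters(2)] by simp
  moreover have "0 < fd_size (T 0) * (sqrt (real CARD('n)) * (H * \<sigma>))"
    using fd_size_0 parameters by (simp add: mult.assoc)
  ultimately show "0 < fd_size (T 0)"
    using zero_less_mult_pos2 by blast
  then have "0 < fd_size (T 0) * sqrt (real CARD('n))" by simp
  with initial show "0 < \<Delta>\<^sub>0" by linarith
qed

lemma \<Delta>\<^sub>m\<^sub>a\<^sub>x_pos: "0 < \<Delta>\<^sub>m\<^sub>a\<^sub>x"
  using \<Delta>\<^sub>0_pos initial by linarith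

text \<open>The invariant of a run. An iteration that starts at Step 3 neither rebuilds the matrix
  nor tests the measure; the last two clauses record that both facts are inherited.\<close>

definition valid :: "nat \<Rightarrow> bool" where
  "valid k \<longleftrightarrow> point (T k) \<in> \<Omega> \<and> h (F (point (T k))) \<le> h (F x\<^sub>0) \<and>
     radius (T k) \<le> \<Delta>\<^sub>m\<^sub>a\<^sub>x \<and> 0 < fd_size (T k) \<and>
     fd_size (T k) * sqrt (real CARD('n)) \<le> radius (T k) \<and> fd_size (T k) \<le> fd_size (T 0) \<and>
     forward_difference F (point (T k)) (fd_size (T k)) (model (T k)) \<and>
     (reaches_step3 p \<Omega> h F \<epsilon> \<Delta>\<^sub>m\<^sub>a\<^sub>x (T k) \<longrightarrow> \<epsilon> / 2 \<le> crit k)"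

lemma valid_radius_pos:
  assumes "valid k"
  shows "0 < radius (T k)"
proof -
  have "0 < fd_size (T k) * sqrt (real CARD('n))"
    using assms by (simp add: valid_def)
  then show ?thesis using assms unfolding valid_def by linarith
qed

text \<open>The trial step keeps the fraction \<open>\<theta>\<close> of the exact decrease, to
  which \<open>model_decrease_exact_ge\<close> applies.\<close>

lemma model_decrease_ge:
  assumes "valid k" "reaches_step3 p \<Omega> h F \<epsilon> \<Delta>\<^sub>m\<^sub>a\<^sub>x (T k)"
  shows "\<theta> * (radius (T k) * crit k) \<le> model_decrease h F (T k) (trial_step (T k))"
proof -
  have adm: "admissible_trial p \<Omega> h F \<theta> (T k)"
    using iteration[of k] assms by (auto simp: trfd_iteration_def)
  have "radius (T k) * crit k \<le> model_decrease h F (T k) (exact_step (T k))"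
    using assms adm valid_radius_pos[of k] p h_convex convex_\<Omega>
    by (intro model_decrease_exact_ge) (auto simp: valid_def admissible_trial_def)
  then have "\<theta> * (radius (T k) * crit k) \<le> \<theta> * model_decrease h F (T k) (exact_step (T k))"
    using parameters by (intro mult_left_mono) auto
  then show ?thesis using adm by (simp add: admissible_trial_def)
qed

text \<open>This permits clearing the denominator of \<open>rho\<close>.\<close>

lemma model_decrease_pos:
  assumes "valid k" "reaches_step3 p \<Omega> h F \<epsilon> \<Delta>\<^sub>m\<^sub>a\<^sub>x (T k)"
  shows "0 < model_decrease h F (T k) (trial_step (T k))"
proof -
  have "0 < crit k"
    using assms parameters by (auto simp: valid_def)
  then have "0 < \<theta> * (radius (T k) * crit k)"
    using valid_radius_pos[OF assms(1)] parameters by simp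
  then show ?thesis using model_decrease_ge[OF assms] by linarith
qed

text \<open>The test on \<open>rho\<close> appears here as an inequality without division. Only
  \<open>valid k\<close> is assumed, so that the rule is available in the induction that establishes
  the invariant.\<close>

lemma step_cases:
  assumes "valid k"
  obtains
    (model_refused) "\<not> reaches_step3 p \<Omega> h F \<epsilon> \<Delta>\<^sub>m\<^sub>a\<^sub>x (T k)" "at_step1 (T (Suc k))"
      "crit k < \<epsilon> / 2" "point (T (Suc k)) = point (T k)" "radius (T (Suc k)) = radius (T k)"
      "fd_size (T (Suc k)) = fd_size (T k) / 2"
  | (success) "reaches_step3 p \<Omega> h F \<epsilon> \<Delta>\<^sub>m\<^sub>a\<^sub>x (T k)" "at_step1 (T (Suc k))"
      "trial_step (T k) \<in> steps p \<Omega> (point (T k)) (radius (T k))"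
      "\<alpha> * model_decrease h F (T k) (trial_step (T k)) \<le> gap k - gap (Suc k)"
      "point (T (Suc k)) = point (T k) + trial_step (T k)"
      "radius (T (Suc k)) = min (2 * radius (T k)) \<Delta>\<^sub>m\<^sub>a\<^sub>x" "fd_size (T (Suc k)) = fd_size (T k)"
  | (failure) "reaches_step3 p \<Omega> h F \<epsilon> \<Delta>\<^sub>m\<^sub>a\<^sub>x (T k)"
      "trial_step (T k) \<in> steps p \<Omega> (point (T k)) (radius (T k))"
      "h (F (point (T k))) - h (F (point (T k) + trial_step (T k)))
         < \<alpha> * model_decrease h F (T k) (trial_step (T k))"
      "point (T (Suc k)) = point (T k)" "radius (T (Suc k)) = radius (T k) / 2"
      "fd_size (T (Suc k)) = fd_size (T k) \<and> model (T (Suc k)) = model (T k) \<and>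
         fd_size (T k) * sqrt (real CARD('n)) \<le> radius (T k) / 2 \<or>
       fd_size (T (Suc k)) = fd_size (T k) / 2 \<and> at_step1 (T (Suc k))"
proof (cases "reaches_step3 p \<Omega> h F \<epsilon> \<Delta>\<^sub>m\<^sub>a\<^sub>x (T k)")
  case False
  then show thesis
    using iteration[of k] model_refused by (auto simp: trfd_iteration_def reaches_step3_def)
next
  case True
  note pos = model_decrease_pos[OF assms True]
  show thesis
  proof (cases "rho h F (T k) \<ge> \<alpha>")
    case rho: True
    show thesis
      using True rho iteration[of k] pos
      by (intro success) (auto simp: trfd_iteration_def admissible_trial_def rho_def field_simps)
  next
    case rho: False
    show thesis
      using True rho iteration[of k] pos
      by (intro failure)
        (auto simp: trfd_iteration_def admissible_trial_def rho_def field_simps split: if_splits)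
  qed
qed

lemma valid: "valid k"
proof (induction k)
  case 0
  have "at_step1 (T 0)" "x\<^sub>0 \<in> \<Omega>" using run by (auto simp: trfd_run_def)
  then show ?case
    using initial fd_size_0_pos iteration[of 0]
    by (auto simp: valid_def trfd_iteration_def reaches_step3_def)
next
  case (Suc k)
  note v = this
  \<comment> \<open>After a return to Step 1 the last two clauses come from the algorithm itself,
    not from the induction hypothesis.\<close>
  have fresh: "forward_difference F (point (T (Suc k))) (fd_size (T (Suc k))) (model (T (Suc k))) \<and>
     (reaches_step3 p \<Omega> h F \<epsilon> \<Delta>\<^sub>m\<^sub>a\<^sub>x (T (Suc k)) \<longrightarrow> \<epsilon> / 2 \<le> crit (Suc k))"
    if "at_step1 (T (Suc k))"
    using that iteration[of "Suc k"] by (auto simp: trfd_iteration_def reaches_step3_def)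
  from v show ?case
  proof (cases rule: step_cases)
    case model_refused
    have "fd_size (T k) / 2 * sqrt (real CARD('n)) \<le> fd_size (T k) * sqrt (real CARD('n))"
      using v by (intro mult_right_mono) (auto simp: valid_def)
    then have "fd_size (T (Suc k)) * sqrt (real CARD('n)) \<le> radius (T (Suc k))"
      using v unfolding model_refused valid_def by linarith
    moreover have "0 < fd_size (T (Suc k))" "fd_size (T (Suc k)) \<le> fd_size (T 0)"
      using v by (auto simp: model_refused(6) valid_def)
    ultimately show ?thesis
      using v fresh[OF model_refused(2)] model_refused(4,5) unfolding valid_def by auto
  next
    case success
    have "0 \<le> \<alpha> * model_decrease h F (T k) (trial_step (T k))"
      using model_decrease_pos[OF v success(1)] parameters by simp
    then have "h (F (point (T (Suc k)))) \<le> h (F (point (T k)))"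
      using success(4) by linarith
    moreover have "radius (T k) \<le> radius (T (Suc k))"
      using success(6) v valid_radius_pos[OF v] by (auto simp: valid_def)
    moreover have "point (T (Suc k)) \<in> \<Omega>"
      using success by (simp add: steps_def)
    ultimately show ?thesis
      using v fresh[OF success(2)] success(6,7) unfolding valid_def by auto
  next
    case failure
    from failure(6) show ?thesis
    proof
      assume *: "fd_size (T (Suc k)) = fd_size (T k) \<and> model (T (Suc k)) = model (T k) \<and>
         fd_size (T k) * sqrt (real CARD('n)) \<le> radius (T k) / 2"
      then show ?thesis
        using v failure valid_radius_pos[OF v] by (auto simp: valid_def)
    next
      \<comment> \<open>Size and radius are halved together, which keeps the inequality between
        them; in the other case that inequality is the test just passed.\<close>
      assume half: "fd_size (T (Suc k)) = fd_size (T k) / 2 \<and> at_step1 (T (Suc k))"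
      have "fd_size (T (Suc k)) * sqrt (real CARD('n)) \<le> radius (T (Suc k))"
        "0 < fd_size (T (Suc k))" "fd_size (T (Suc k)) \<le> fd_size (T 0)"
        "radius (T (Suc k)) \<le> \<Delta>\<^sub>m\<^sub>a\<^sub>x"
        using v valid_radius_pos[OF v] by (simp_all add: failure(5) half valid_def)
      then show ?thesis
        using v failure(4) fresh[OF conjunct2[OF half]] unfolding valid_def by auto
    qed
  qed
qed

section \<open>The criticality measure compared with the gap and the radius\<close>

lemmas radius_pos = valid_radius_pos[OF valid]

text \<open>The step to the minimizer is admissible for the radius
  \<open>\<Delta>\<^sub>m\<^sub>a\<^sub>x\<close> by the bound on the level set. Convexity and
  monotonicity give it at least the decrease \<open>gap k\<close> in the exact linearization; the
  subtracted term is the discretization error.\<close>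

lemma crit_ge:
  "gap k / \<Delta>\<^sub>m\<^sub>a\<^sub>x - L\<^sub>J * sqrt (real CARD('n)) * fd_size (T k) * H / 2 \<le> crit k"
proof -
  define x s A \<tau> where "x = point (T k)" and "s = x\<^sub>s - x" and "A = model (T k)" and "\<tau> = fd_size (T k)"
  have v: "x \<in> \<Omega>" "h (F x) \<le> h (F x\<^sub>0)" "0 < \<tau>" "forward_difference F x \<tau> A"
    using valid[of k] by (auto simp: valid_def x_def A_def \<tau>_def)
  have pnorm_s: "pnorm p s \<le> \<Delta>\<^sub>m\<^sub>a\<^sub>x"
    using level_set[OF v(1,2)] pnorm_minus[of p s] by (simp add: s_def)
  then have norm_s: "norm s \<le> c2p * \<Delta>\<^sub>m\<^sub>a\<^sub>x"
    using norm_le[of s] mult_left_mono[OF pnorm_s, of c2p] constants by linarith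
  have "h (F x + jacobian F (at x) *v s) \<le> h (F x\<^sub>s)"
    using convex_above_jacobian[OF diff convex, of x s] by (intro h_mono) (simp add: s_def)
  moreover have "h (F x + A *v s) - h (F x + jacobian F (at x) *v s)
      \<le> Lh * cp2 * (L\<^sub>J * sqrt (real CARD('n)) * \<tau> / 2 * (c2p * \<Delta>\<^sub>m\<^sub>a\<^sub>x))"
  proof -
    have "h (F x + A *v s) - h (F x + jacobian F (at x) *v s)
        \<le> Lh * cp2 * norm (A *v s - jacobian F (at x) *v s)"
      using h_lipschitz[of "F x + A *v s" "F x + jacobian F (at x) *v s"] by simp
    also have "\<dots> \<le> Lh * cp2 * (L\<^sub>J * sqrt (real CARD('n)) * \<tau> / 2 * norm s)"
      using constants by (intro mult_left_mono forward_difference_error diff lipschitz v) auto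
    also have "\<dots> \<le> Lh * cp2 * (L\<^sub>J * sqrt (real CARD('n)) * \<tau> / 2 * (c2p * \<Delta>\<^sub>m\<^sub>a\<^sub>x))"
      using constants norm_s L_nonneg v by (intro mult_left_mono) auto
    finally show ?thesis .
  qed
  ultimately have "h (F x) - h (F x\<^sub>s) - Lh * cp2 * (L\<^sub>J * sqrt (real CARD('n)) * \<tau> / 2 * (c2p * \<Delta>\<^sub>m\<^sub>a\<^sub>x))
      \<le> h (F x) - h (F x + A *v s)" by linarith
  then have "(h (F x) - h (F x\<^sub>s) - Lh * cp2 * (L\<^sub>J * sqrt (real CARD('n)) * \<tau> / 2 * (c2p * \<Delta>\<^sub>m\<^sub>a\<^sub>x))) / \<Delta>\<^sub>m\<^sub>a\<^sub>x
      \<le> (h (F x) - h (F x + A *v s)) / \<Delta>\<^sub>m\<^sub>a\<^sub>x"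
    using \<Delta>\<^sub>m\<^sub>a\<^sub>x_pos by (intro divide_right_mono) auto
  also have "\<dots> \<le> eta p \<Omega> h F \<Delta>\<^sub>m\<^sub>a\<^sub>x x A"
    using h_lipschitz norm_le
    by (rule eta_ge) (use pnorm_s minimizer constants \<Delta>\<^sub>m\<^sub>a\<^sub>x_pos in \<open>auto simp: steps_def s_def\<close>)
  finally show ?thesis
    using \<Delta>\<^sub>m\<^sub>a\<^sub>x_pos by (simp add: x_def A_def \<tau>_def field_simps)
qed

text \<open>In the iterations that reach Step 3 the discretization error is at most \<open>L\<^sub>J/\<sigma>\<close> times the
  criticality measure itself, because the latter is at least \<open>\<epsilon>/2\<close>.\<close>

lemma crit_ge_gap:
  assumes "reaches_step3 p \<Omega> h F \<epsilon> \<Delta>\<^sub>m\<^sub>a\<^sub>x (T k)"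
  shows "gap k \<le> (L\<^sub>J / \<sigma> + 1) * \<Delta>\<^sub>m\<^sub>a\<^sub>x * crit k"
proof -
  \<comment> \<open>The size never grows, and its initial value is normalized so that this product
    is \<open>\<epsilon>\<close>.\<close>
  have "fd_size (T k) * (sqrt (real CARD('n)) * (H * \<sigma>)) \<le> fd_size (T 0) * (sqrt (real CARD('n)) * (H * \<sigma>))"
    using valid[of k] H_pos parameters by (intro mult_right_mono) (auto simp: valid_def)
  also have "\<dots> = \<epsilon>" using fd_size_0 by (simp add: mult.assoc)
  also have "\<epsilon> \<le> 2 * crit k" using valid[of k] assms by (simp add: valid_def)
  finally have "L\<^sub>J / \<sigma> * (fd_size (T k) * (sqrt (real CARD('n)) * (H * \<sigma>))) \<le> L\<^sub>J / \<sigma> * (2 * crit k)"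
    using L_nonneg parameters by (intro mult_left_mono) auto
  also have "L\<^sub>J / \<sigma> * (fd_size (T k) * (sqrt (real CARD('n)) * (H * \<sigma>)))
      = L\<^sub>J * sqrt (real CARD('n)) * fd_size (T k) * H"
    using parameters by simp
  finally have "L\<^sub>J * sqrt (real CARD('n)) * fd_size (T k) * H / 2 \<le> L\<^sub>J / \<sigma> * (2 * crit k) / 2"
    by (rule divide_right_mono) simp
  also have "\<dots> = L\<^sub>J / \<sigma> * crit k" by simp
  finally have "L\<^sub>J * sqrt (real CARD('n)) * fd_size (T k) * H / 2 \<le> L\<^sub>J / \<sigma> * crit k" .
  then have "gap k / \<Delta>\<^sub>m\<^sub>a\<^sub>x \<le> (L\<^sub>J / \<sigma> + 1) * crit k"
    using crit_ge[of k] unfolding distrib_right by linarith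
  then show ?thesis
    using \<Delta>\<^sub>m\<^sub>a\<^sub>x_pos by (simp add: pos_divide_le_eq mult.commute mult.left_commute)
qed

text \<open>At a failure the error of the model exceeds \<open>1 - \<alpha>\<close> times the
  predicted decrease, which is at least a multiple of \<open>r * crit k\<close>. The error is of
  order \<open>r * r\<close>, so one factor \<open>r\<close> cancels.\<close>

lemma failure_radius:
  assumes step3: "reaches_step3 p \<Omega> h F \<epsilon> \<Delta>\<^sub>m\<^sub>a\<^sub>x (T k)"
    and step: "trial_step (T k) \<in> steps p \<Omega> (point (T k)) (radius (T k))"
    and fail: "h (F (point (T k))) - h (F (point (T k) + trial_step (T k)))
         < \<alpha> * model_decrease h F (T k) (trial_step (T k))"
  shows "(1 - \<alpha>) * \<theta> * crit k < L\<^sub>J * H * c2p * radius (T k)"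
proof -
  define x s A \<tau> r where "x = point (T k)" and "s = trial_step (T k)" and "A = model (T k)"
    and "\<tau> = fd_size (T k)" and "r = radius (T k)"
  have v: "0 < \<tau>" "forward_difference F x \<tau> A" "sqrt (real CARD('n)) * \<tau> \<le> r"
    using valid[of k] by (auto simp: valid_def x_def A_def \<tau>_def r_def mult.commute)
  have r: "0 < r" using radius_pos by (simp add: r_def)
  have norm_s: "norm s \<le> c2p * r"
  proof -
    have "c2p * pnorm p s \<le> c2p * r"
      using step constants by (intro mult_left_mono) (auto simp: steps_def s_def r_def)
    then show ?thesis using norm_le[of s] by linarith
  qed
  have "norm (F (x + s) - (F x + A *v s))
      \<le> norm (F (x + s) - F x - jacobian F (at x) *v s) + norm (A *v s - jacobian F (at x) *v s)"
    using norm_triangle_ineq4[of "F (x + s) - F x - jacobian F (at x) *v s" "A *v s - jacobian F (at x) *v s"]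
    by (simp add: algebra_simps)
  also have "\<dots> \<le> L\<^sub>J / 2 * (norm s)\<^sup>2 + L\<^sub>J * sqrt (real CARD('n)) * \<tau> / 2 * norm s"
    by (intro add_mono jacobian_taylor forward_difference_error diff lipschitz v)
  also have "\<dots> = L\<^sub>J / 2 * ((norm s + sqrt (real CARD('n)) * \<tau>) * norm s)"
    by (simp add: power2_eq_square algebra_simps)
  \<comment> \<open>The invariant keeps the discretization term below \<open>r\<close>, hence below
    \<open>c2p * r\<close>: Taylor remainder and discretization error get the same bound.\<close>
  also have "\<dots> \<le> L\<^sub>J / 2 * ((c2p * r + c2p * r) * (c2p * r))"
  proof -
    have "r \<le> c2p * r" using r constants by simp
    then show ?thesis
      using norm_s v(1) order_trans[OF v(3)] r constants L_nonneg
      by (intro mult_left_mono mult_mono[OF add_mono[OF norm_s]]) auto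
  qed
  also have "\<dots> = L\<^sub>J * c2p * c2p * r * r" by simp
  finally have err: "norm (F (x + s) - (F x + A *v s)) \<le> L\<^sub>J * c2p * c2p * r * r" .
  have "(1 - \<alpha>) * (\<theta> * (r * crit k)) \<le> (1 - \<alpha>) * model_decrease h F (T k) s"
    using model_decrease_ge[OF valid step3] parameters
    by (intro mult_left_mono) (auto simp: r_def s_def)
  \<comment> \<open>The right-hand side is the predicted minus the actual decrease.\<close>
  also have "\<dots> < h (F (x + s)) - h (F x + A *v s)"
    using fail unfolding model_decrease_def x_def s_def A_def by (simp add: algebra_simps)
  also have "\<dots> \<le> Lh * cp2 * norm (F (x + s) - (F x + A *v s))"
    using h_lipschitz[of "F (x + s)" "F x + A *v s"] by simp
  also have "\<dots> \<le> Lh * cp2 * (L\<^sub>J * c2p * c2p * r * r)"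
    using err constants by (intro mult_left_mono) auto
  finally have "r * ((1 - \<alpha>) * \<theta> * crit k) < r * (L\<^sub>J * H * c2p * r)"
    by (simp add: algebra_simps)
  then show ?thesis using r by (simp add: r_def)
qed

end

text \<open>\<open>1 / b - 1 / a = (a - b) / (a * b) \<ge> c * a / b \<ge> c\<close>, since
  \<open>b \<le> a\<close>.\<close>

lemma inverse_increase_ge:
  fixes a b c :: real
  assumes "0 < b" "0 \<le> c" "c * a\<^sup>2 \<le> a - b"
  shows "1 / a + c \<le> 1 / b"
proof -
  have ab: "b \<le> a" using assms by (smt (verit) mult_nonneg_nonneg zero_le_power2)
  have "c \<le> c * a\<^sup>2 / (a * b)"
    using assms ab by (simp add: power2_eq_square field_simps mult_right_mono)
  also have "\<dots> \<le> (a - b) / (a * b)"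
    using assms ab by (intro divide_right_mono) auto
  also have "\<dots> = 1 / b - 1 / a"
    using assms ab by (simp add: field_simps)
  finally show ?thesis by simp
qed

section \<open>Lower bounds on the radius and the count of the iterations\<close>

context trfd
begin

abbreviation \<beta> :: real where
  "\<beta> \<equiv> beta Lh cp2 c2p L\<^sub>J \<sigma> \<alpha> \<theta> \<Delta>\<^sub>0 \<Delta>\<^sub>m\<^sub>a\<^sub>x (gap 0)"

lemma gap_nonneg: "0 \<le> gap k"
  using minimizer(2)[of "point (T k)"] valid[of k] by (simp add: valid_def)

lemma beta_nonneg: "0 \<le> \<beta>"
  using gap_nonneg[of 0] \<Delta>\<^sub>0_pos by (simp add: beta_def le_max_iff_disj)

text \<open>The first term of the maximum in \<open>beta\<close> settles the start. The second
  settles failures, by \<open>crit_ge_gap\<close> and \<open>failure_radius\<close>; its factor 2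
  pays for the halved radius. A success lowers the gap without shrinking the radius.\<close>

lemma gap_le_radius: "gap k \<le> \<beta> * radius (T k)"
proof (induction k)
  case 0
  have "gap 0 / \<Delta>\<^sub>0 \<le> \<beta>" by (simp add: beta_def)
  then show ?case using \<Delta>\<^sub>0_pos initial by (simp add: pos_divide_le_eq)
next
  case (Suc k)
  from valid[of k] show ?case
  proof (cases rule: step_cases)
    case model_refused
    then show ?thesis using Suc by simp
  next
    case success
    have "0 \<le> \<alpha> * model_decrease h F (T k) (trial_step (T k))"
      using model_decrease_pos[OF valid success(1)] parameters by simp
    then have "gap (Suc k) \<le> gap k" using success(4) by linarith
    also have "\<dots> \<le> \<beta> * radius (T k)" by (rule Suc)
    also have "\<dots> \<le> \<beta> * radius (T (Suc k))"
      using success(6) valid[of k] radius_pos[of k] beta_nonneg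
      by (intro mult_left_mono) (auto simp: valid_def)
    finally show ?thesis .
  next
    case failure
    have q: "0 < (1 - \<alpha>) * \<theta>" using parameters by simp
    have "((1 - \<alpha>) * \<theta>) * gap k \<le> ((1 - \<alpha>) * \<theta>) * ((L\<^sub>J / \<sigma> + 1) * \<Delta>\<^sub>m\<^sub>a\<^sub>x * crit k)"
      using crit_ge_gap[OF failure(1)] q by (intro mult_left_mono) auto
    also have "\<dots> = ((L\<^sub>J / \<sigma> + 1) * \<Delta>\<^sub>m\<^sub>a\<^sub>x) * ((1 - \<alpha>) * \<theta> * crit k)"
      by (simp only: mult_ac)
    also have "\<dots> \<le> ((L\<^sub>J / \<sigma> + 1) * \<Delta>\<^sub>m\<^sub>a\<^sub>x) * (L\<^sub>J * H * c2p * radius (T k))"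
      using failure_radius[OF failure(1-3)] L_nonneg parameters \<Delta>\<^sub>m\<^sub>a\<^sub>x_pos
      by (intro mult_left_mono) auto
    finally have "gap k \<le> ((L\<^sub>J / \<sigma> + 1) * \<Delta>\<^sub>m\<^sub>a\<^sub>x) * (L\<^sub>J * H * c2p * radius (T k)) / ((1 - \<alpha>) * \<theta>)"
      using q by (simp add: pos_le_divide_eq mult.commute)
    also have "\<dots> = 2 * (L\<^sub>J / \<sigma> + 1) * \<Delta>\<^sub>m\<^sub>a\<^sub>x * Lh * L\<^sub>J * cp2 * c2p\<^sup>2 / ((1 - \<alpha>) * \<theta>) * (radius (T k) / 2)"
    proof -
      have "w * D * (L\<^sub>J * H * c2p * r) / q = 2 * w * D * Lh * L\<^sub>J * cp2 * c2p\<^sup>2 / q * (r / 2)"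
        for w D q r :: real by (simp add: power2_eq_square)
      then show ?thesis .
    qed
    also have "\<dots> \<le> \<beta> * (radius (T k) / 2)"
      using radius_pos[of k] by (intro mult_right_mono) (auto simp: beta_def)
    finally show ?thesis by (simp add: failure(4,5))
  qed
qed

text \<open>At a failure the measure is at least \<open>\<epsilon> / 2\<close> and the radius is
  halved, whence the factor 4. The entry \<open>\<sigma>\<close> of the maximum serves the start,
  where the radius is at least \<open>\<epsilon> / (H * \<sigma>)\<close>.\<close>

lemma radius_ge: "(1 - \<alpha>) * \<theta> * \<epsilon> \<le> 4 * max \<sigma> L\<^sub>J * H * c2p * radius (T k)"
proof (induction k)
  case 0
  have "(1 - \<alpha>) * \<theta> * \<epsilon> \<le> 1 * 1 * \<epsilon>"
    using parameters by (intro mult_mono) auto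
  also have "\<dots> = (fd_size (T 0) * sqrt (real CARD('n))) * (H * \<sigma>)"
    using fd_size_0 by simp
  also have "\<dots> \<le> \<Delta>\<^sub>0 * (H * \<sigma>)"
    using initial H_pos parameters by (intro mult_right_mono) auto
  also have "\<dots> = 1 * \<sigma> * H * 1 * \<Delta>\<^sub>0" by simp
  also have "\<dots> \<le> 4 * max \<sigma> L\<^sub>J * H * c2p * \<Delta>\<^sub>0"
    using parameters constants H_pos \<Delta>\<^sub>0_pos by (intro mult_mono) auto
  finally show ?case by (simp add: initial)
next
  case (Suc k)
  from valid[of k] show ?case
  proof (cases rule: step_cases)
    case model_refused
    then show ?thesis using Suc by simp
  next
    case success
    have "radius (T k) \<le> radius (T (Suc k))"
      using success(6) valid[of k] radius_pos[of k] by (auto simp: valid_def)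
    then have "4 * max \<sigma> L\<^sub>J * H * c2p * radius (T k) \<le> 4 * max \<sigma> L\<^sub>J * H * c2p * radius (T (Suc k))"
      using parameters constants H_pos by (intro mult_left_mono) auto
    with Suc show ?thesis by linarith
  next
    case failure
    have "(1 - \<alpha>) * \<theta> * \<epsilon> \<le> (1 - \<alpha>) * \<theta> * (2 * crit k)"
      using valid[of k] failure(1) parameters by (intro mult_left_mono) (auto simp: valid_def)
    also have "\<dots> \<le> 2 * (L\<^sub>J * H * c2p * radius (T k))"
      using failure_radius[OF failure(1-3)] by simp
    also have "\<dots> = 4 * L\<^sub>J * H * c2p * (radius (T k) / 2)" by simp
    also have "\<dots> \<le> 4 * max \<sigma> L\<^sub>J * H * c2p * (radius (T k) / 2)"
      using constants H_pos L_nonneg radius_pos[of k]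
      by (intro mult_right_mono) auto
    finally show ?thesis by (simp add: failure(4,5))
  qed
qed

text \<open>The decrease is at least \<open>\<alpha> * \<theta>\<close> times radius times measure,
  and each of these two factors dominates a multiple of the gap.\<close>

lemma success_inverse_gap:
  assumes step3: "reaches_step3 p \<Omega> h F \<epsilon> \<Delta>\<^sub>m\<^sub>a\<^sub>x (T k)"
    and decrease: "\<alpha> * model_decrease h F (T k) (trial_step (T k)) \<le> gap k - gap (Suc k)"
    and pos: "0 < gap k" "0 < gap (Suc k)"
  shows "1 / gap k + \<alpha> * \<theta> / ((L\<^sub>J / \<sigma> + 1) * \<Delta>\<^sub>m\<^sub>a\<^sub>x * \<beta>) \<le> 1 / gap (Suc k)"
proof (rule inverse_increase_ge)
  \<comment> \<open>The invariant yields only \<open>0 \<le> \<beta>\<close>; strictness comes from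
    the positive gap.\<close>
  have "0 < \<beta> * radius (T k)" using pos gap_le_radius[of k] by linarith
  then have \<beta>: "0 < \<beta>" using radius_pos[of k] zero_less_mult_pos2 by blast
  have w: "0 < (L\<^sub>J / \<sigma> + 1) * \<Delta>\<^sub>m\<^sub>a\<^sub>x"
    using L_nonneg parameters \<Delta>\<^sub>m\<^sub>a\<^sub>x_pos by (intro mult_pos_pos add_nonneg_pos) auto
  show "0 \<le> \<alpha> * \<theta> / ((L\<^sub>J / \<sigma> + 1) * \<Delta>\<^sub>m\<^sub>a\<^sub>x * \<beta>)"
    using parameters by (intro divide_nonneg_pos mult_pos_pos[OF w \<beta>]) auto
  have r: "gap k / \<beta> \<le> radius (T k)"
    using gap_le_radius[of k] \<beta> by (simp add: pos_divide_le_eq mult.commute)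
  have c: "gap k / ((L\<^sub>J / \<sigma> + 1) * \<Delta>\<^sub>m\<^sub>a\<^sub>x) \<le> crit k"
    using crit_ge_gap[OF step3] w by (simp add: pos_divide_le_eq mult.commute)
  have "\<alpha> * \<theta> / ((L\<^sub>J / \<sigma> + 1) * \<Delta>\<^sub>m\<^sub>a\<^sub>x * \<beta>) * (gap k)\<^sup>2
      = \<alpha> * (\<theta> * (gap k / \<beta> * (gap k / ((L\<^sub>J / \<sigma> + 1) * \<Delta>\<^sub>m\<^sub>a\<^sub>x))))"
    by (simp add: power2_eq_square mult_ac)
  also have "\<dots> \<le> \<alpha> * (\<theta> * (radius (T k) * crit k))"
    using r c pos \<beta> w radius_pos[of k] parameters
    by (intro mult_left_mono mult_mono divide_nonneg_pos) auto
  also have "\<dots> \<le> \<alpha> * model_decrease h F (T k) (trial_step (T k))"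
    using model_decrease_ge[OF valid step3] parameters by (intro mult_left_mono) auto
  finally show "\<alpha> * \<theta> / ((L\<^sub>J / \<sigma> + 1) * \<Delta>\<^sub>m\<^sub>a\<^sub>x * \<beta>) * (gap k)\<^sup>2 \<le> gap k - gap (Suc k)"
    using decrease by linarith
qed (rule pos)

text \<open>The witnesses count the successful iterations, the failures and the refused models.\<close>

lemma iteration_counts:
  assumes "\<forall>k\<le>j. \<Delta>\<^sub>m\<^sub>a\<^sub>x * \<epsilon> < gap k"
  shows "\<exists>s u r :: nat. j = s + u + r \<and>
     real s * (\<alpha> * \<theta> / ((L\<^sub>J / \<sigma> + 1) * \<Delta>\<^sub>m\<^sub>a\<^sub>x * \<beta>)) \<le> 1 / gap j \<and>
     radius (T j) * 2 ^ u \<le> \<Delta>\<^sub>0 * 2 ^ s \<and>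
     fd_size (T j) * 2 ^ r \<le> fd_size (T 0) \<and> (r = 0 \<or> \<sigma> * 2 ^ r \<le> 2 * L\<^sub>J)"
  using assms
proof (induction j)
  case 0
  then show ?case
    using initial gap_nonneg[of 0] by (intro exI[of _ 0]) auto
next
  case (Suc k)
  then obtain s u r where k: "k = s + u + r"
    and s: "real s * (\<alpha> * \<theta> / ((L\<^sub>J / \<sigma> + 1) * \<Delta>\<^sub>m\<^sub>a\<^sub>x * \<beta>)) \<le> 1 / gap k"
    and u: "radius (T k) * 2 ^ u \<le> \<Delta>\<^sub>0 * 2 ^ s"
    and r: "fd_size (T k) * 2 ^ r \<le> fd_size (T 0)" "r = 0 \<or> \<sigma> * 2 ^ r \<le> 2 * L\<^sub>J"
    by auto
  have large: "\<Delta>\<^sub>m\<^sub>a\<^sub>x * \<epsilon> < gap k" "\<Delta>\<^sub>m\<^sub>a\<^sub>x * \<epsilon> < gap (Suc k)"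
    using Suc.prems by auto
  have \<tau>: "0 < fd_size (T k)" using valid[of k] by (simp add: valid_def)
  from valid[of k] show ?case
  proof (cases rule: step_cases)
    case model_refused
    \<comment> \<open>The measure is below \<open>\<epsilon> / 2\<close> although
      \<open>gap k / \<Delta>\<^sub>m\<^sub>a\<^sub>x\<close> exceeds \<open>\<epsilon>\<close>, so
      the discretization error accounts for more than \<open>\<epsilon> / 2\<close> and the size is
      still large.\<close>
    have "\<epsilon> < gap k / \<Delta>\<^sub>m\<^sub>a\<^sub>x"
      using large \<Delta>\<^sub>m\<^sub>a\<^sub>x_pos by (simp add: pos_less_divide_eq mult.commute)
    then have "\<epsilon> < L\<^sub>J * sqrt (real CARD('n)) * fd_size (T k) * H"
      using crit_ge[of k] model_refused(3) by linarith
    then have "(\<sigma> * fd_size (T 0)) * (sqrt (real CARD('n)) * H)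
        < (L\<^sub>J * fd_size (T k)) * (sqrt (real CARD('n)) * H)"
      using fd_size_0 by (simp add: mult_ac)
    then have "\<sigma> * fd_size (T 0) < L\<^sub>J * fd_size (T k)"
      using H_pos by (subst (asm) mult_less_cancel_right_pos) simp_all
    moreover have "\<sigma> * (fd_size (T k) * 2 ^ r) \<le> \<sigma> * fd_size (T 0)"
      using r parameters by (intro mult_left_mono) auto
    ultimately have "fd_size (T k) * (\<sigma> * 2 ^ r) < fd_size (T k) * L\<^sub>J"
      by (simp add: mult_ac)
    \<comment> \<open>This holds for the refusals before the present one; counting it as well gives
      the factor 2 in the invariant. Before any refusal there is no such bound, hence the
      alternative \<open>r = 0\<close>.\<close>
    then have "\<sigma> * 2 ^ r < L\<^sub>J" using \<tau> by simp
    moreover have "fd_size (T (Suc k)) * 2 ^ Suc r \<le> fd_size (T 0)"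
      using r(1) by (simp add: model_refused(6))
    moreover have "real s * (\<alpha> * \<theta> / ((L\<^sub>J / \<sigma> + 1) * \<Delta>\<^sub>m\<^sub>a\<^sub>x * \<beta>)) \<le> 1 / gap (Suc k)"
      using s by (simp only: model_refused(4))
    ultimately show ?thesis
      using k u model_refused(5)
      by (intro exI[of _ s] exI[of _ u] exI[of _ "Suc r"]) auto
  next
    case success
    have "0 < \<Delta>\<^sub>m\<^sub>a\<^sub>x * \<epsilon>" using \<Delta>\<^sub>m\<^sub>a\<^sub>x_pos parameters by simp
    then have "0 < gap k" "0 < gap (Suc k)" using large by linarith+
    from success_inverse_gap[OF success(1,4) this]
    have "real (Suc s) * (\<alpha> * \<theta> / ((L\<^sub>J / \<sigma> + 1) * \<Delta>\<^sub>m\<^sub>a\<^sub>x * \<beta>)) \<le> 1 / gap (Suc k)"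
      using s by (simp only: of_nat_Suc distrib_right)
    moreover have "radius (T (Suc k)) * 2 ^ u \<le> \<Delta>\<^sub>0 * 2 ^ Suc s"
    proof -
      have "radius (T (Suc k)) * 2 ^ u \<le> (2 * radius (T k)) * 2 ^ u"
        using success(6) by (intro mult_right_mono) auto
      also have "\<dots> = 2 * (radius (T k) * 2 ^ u)" by simp
      also have "\<dots> \<le> 2 * (\<Delta>\<^sub>0 * 2 ^ s)" using u by simp
      finally show ?thesis by simp
    qed
    ultimately show ?thesis
      using k r success(7)
      by (intro exI[of _ "Suc s"] exI[of _ u] exI[of _ r]) auto
  next
    case failure
    \<comment> \<open>A failure may halve the size too, but \<open>r\<close> counts refusals only;
      the invariant on the size is therefore an inequality.\<close>
    have "fd_size (T (Suc k)) \<le> fd_size (T k)" using failure(6) \<tau> by auto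
    then have "fd_size (T (Suc k)) * 2 ^ r \<le> fd_size (T k) * 2 ^ r"
      by (intro mult_right_mono) auto
    then have "fd_size (T (Suc k)) * 2 ^ r \<le> fd_size (T 0)" using r by linarith
    moreover have "radius (T (Suc k)) * 2 ^ Suc u \<le> \<Delta>\<^sub>0 * 2 ^ s"
      using u by (simp add: failure(5))
    moreover have "real s * (\<alpha> * \<theta> / ((L\<^sub>J / \<sigma> + 1) * \<Delta>\<^sub>m\<^sub>a\<^sub>x * \<beta>)) \<le> 1 / gap (Suc k)"
      using s by (simp only: failure(4))
    ultimately show ?thesis
      using k r(2)
      by (intro exI[of _ s] exI[of _ "Suc u"] exI[of _ r]) auto
  qed
qed

text \<open>Successes are limited by the growth of the reciprocal gap, which stays below
  \<open>1 / (\<Delta>\<^sub>m\<^sub>a\<^sub>x * \<epsilon>)\<close>. Failures exceed successes by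
  at most a logarithm, because the radius is bounded below. Refusals are limited by
  \<open>2 * L\<^sub>J / \<sigma>\<close>.\<close>

lemma iterations_bounded:
  assumes "\<forall>k\<le>j. \<Delta>\<^sub>m\<^sub>a\<^sub>x * \<epsilon> < gap k"
  shows "(real CARD('n) + 1) * (real j + 2)
    \<le> trfd_bound CARD('n) Lh cp2 c2p L\<^sub>J \<sigma> \<alpha> \<theta> \<Delta>\<^sub>0 \<Delta>\<^sub>m\<^sub>a\<^sub>x (gap 0) \<epsilon>"
proof -
  obtain s u r :: nat where j: "j = s + u + r"
    and s: "real s * (\<alpha> * \<theta> / ((L\<^sub>J / \<sigma> + 1) * \<Delta>\<^sub>m\<^sub>a\<^sub>x * \<beta>)) \<le> 1 / gap j"
    and u: "radius (T j) * 2 ^ u \<le> \<Delta>\<^sub>0 * 2 ^ s"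
    and r: "r = 0 \<or> \<sigma> * 2 ^ r \<le> 2 * L\<^sub>J"
    using iteration_counts[OF assms] by blast
  \<comment> \<open>By \<open>radius_ge\<close>, \<open>Y\<close> bounds the ratio of
    \<open>\<Delta>\<^sub>0\<close> to any radius of the run. \<open>Z\<close> will bound
    \<open>2 ^ r\<close> as soon as a model has been refused.\<close>
  define Y where "Y = 4 * Lh * max \<sigma> L\<^sub>J * cp2 * c2p\<^sup>2 * \<Delta>\<^sub>0 / ((1 - \<alpha>) * \<theta>) * inverse \<epsilon>"
  define Z where "Z = 4 * max \<sigma> L\<^sub>J * c2p / (\<sigma> * (1 - \<alpha>) * \<theta>)"
  have q: "0 < (1 - \<alpha>) * \<theta>" "(1 - \<alpha>) * \<theta> \<le> 1"
    using parameters by (auto intro: mult_le_one)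
  have large: "\<Delta>\<^sub>m\<^sub>a\<^sub>x * \<epsilon> < gap j" using assms by simp
  have \<Delta>\<epsilon>: "0 < \<Delta>\<^sub>m\<^sub>a\<^sub>x * \<epsilon>" using \<Delta>\<^sub>m\<^sub>a\<^sub>x_pos parameters by simp
  have "0 < \<beta> * radius (T j)" using large \<Delta>\<epsilon> gap_le_radius[of j] by linarith
  then have \<beta>: "0 < \<beta>" using radius_pos[of j] zero_less_mult_pos2 by blast
  have w: "0 < L\<^sub>J / \<sigma> + 1" using L_nonneg parameters by (intro add_nonneg_pos) auto
  have "1 / gap j \<le> 1 / (\<Delta>\<^sub>m\<^sub>a\<^sub>x * \<epsilon>)"
    using large \<Delta>\<epsilon> by (intro frac_le) auto
  with s have "real s * (\<alpha> * \<theta> / ((L\<^sub>J / \<sigma> + 1) * \<Delta>\<^sub>m\<^sub>a\<^sub>x * \<beta>)) \<le> 1 / (\<Delta>\<^sub>m\<^sub>a\<^sub>x * \<epsilon>)" by linarith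
  then have "real s \<le> 1 / (\<Delta>\<^sub>m\<^sub>a\<^sub>x * \<epsilon>) / (\<alpha> * \<theta> / ((L\<^sub>J / \<sigma> + 1) * \<Delta>\<^sub>m\<^sub>a\<^sub>x * \<beta>))"
    using w \<beta> \<Delta>\<^sub>m\<^sub>a\<^sub>x_pos parameters by (subst pos_le_divide_eq) (auto intro!: divide_pos_pos mult_pos_pos)
  also have "\<dots> = (L\<^sub>J / \<sigma> + 1) * \<beta> / (\<alpha> * \<theta>) * inverse \<epsilon>"
    using \<Delta>\<^sub>m\<^sub>a\<^sub>x_pos by (simp add: divide_inverse)
  finally have s': "real s \<le> (L\<^sub>J / \<sigma> + 1) * \<beta> / (\<alpha> * \<theta>) * inverse \<epsilon>" .
  have u': "real u \<le> real s + log 2 Y"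
  proof -
    have "((1 - \<alpha>) * \<theta> * \<epsilon>) * 2 ^ u \<le> (4 * max \<sigma> L\<^sub>J * H * c2p * radius (T j)) * 2 ^ u"
      using radius_ge[of j] by (intro mult_right_mono) auto
    also have "\<dots> = (4 * max \<sigma> L\<^sub>J * H * c2p) * (radius (T j) * 2 ^ u)" by simp
    also have "\<dots> \<le> (4 * max \<sigma> L\<^sub>J * H * c2p) * (\<Delta>\<^sub>0 * 2 ^ s)"
      using u H_pos constants parameters by (intro mult_left_mono) auto
    finally have "2 ^ u \<le> (4 * max \<sigma> L\<^sub>J * H * c2p) * (\<Delta>\<^sub>0 * 2 ^ s) / ((1 - \<alpha>) * \<theta> * \<epsilon>)"
      using q parameters by (subst pos_le_divide_eq) (auto simp: mult.commute)
    also have "\<dots> = 2 ^ s * Y"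
      by (simp add: Y_def power2_eq_square divide_inverse mult_ac)
    finally have le: "(2::real) ^ u \<le> 2 ^ s * Y" .
    have Y: "0 < Y"
    proof -
      have "0 < 2 ^ s * Y" using le by (smt (verit) zero_less_power)
      then show ?thesis by (simp add: zero_less_mult_iff)
    qed
    have "real u = log 2 (2 ^ u)" by simp
    also have "\<dots> \<le> log 2 (2 ^ s * Y)" using le by (subst log_le_cancel_iff) (auto simp: Y)
    also have "\<dots> = real s + log 2 Y" using Y by (simp add: log_mult)
    finally show ?thesis .
  qed
  have r': "real r \<le> real_of_int \<lceil>\<bar>log 2 Z\<bar>\<rceil>"
  proof (cases "r = 0")
    case False
    then have "2 ^ r \<le> 2 * L\<^sub>J / \<sigma>"
      using r parameters by (simp add: pos_le_divide_eq mult.commute)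
    also have "\<dots> \<le> 4 * max \<sigma> L\<^sub>J * c2p / \<sigma>"
    proof -
      have "2 * L\<^sub>J * 1 \<le> 4 * max \<sigma> L\<^sub>J * c2p"
        using L_nonneg constants parameters by (intro mult_mono) auto
      then show ?thesis using parameters by (simp add: divide_right_mono)
    qed
    also have "\<dots> \<le> 4 * max \<sigma> L\<^sub>J * c2p / \<sigma> / ((1 - \<alpha>) * \<theta>)"
    proof -
      have "0 \<le> 4 * max \<sigma> L\<^sub>J * c2p / \<sigma>" using constants parameters by simp
      then show ?thesis
        using q mult_left_le[of "(1 - \<alpha>) * \<theta>" "4 * max \<sigma> L\<^sub>J * c2p / \<sigma>"]
        by (subst pos_le_divide_eq) auto
    qed
    also have "\<dots> = Z" by (simp add: Z_def)
    finally have le: "(2::real) ^ r \<le> Z" .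
    then have "0 < Z" by (smt (verit) zero_less_power)
    have "real r = log 2 (2 ^ r)" by simp
    also have "\<dots> \<le> log 2 Z" using le \<open>0 < Z\<close> by (subst log_le_cancel_iff) auto
    finally show ?thesis by linarith
  qed simp
  have "real j + 2 \<le> 2 * (1 + (L\<^sub>J / \<sigma> + 1) * \<beta> / (\<alpha> * \<theta>) * inverse \<epsilon>)
      + real_of_int \<lceil>\<bar>log 2 Z\<bar>\<rceil> + log 2 Y"
    using j s' u' r' by simp
  then show ?thesis
    unfolding trfd_bound_def Y_def Z_def by (intro mult_left_mono) auto
qed

text \<open>Serves a starting point that is already accurate, where one evaluation is counted. The
  second logarithm is nonnegative because its argument bounds
  \<open>\<Delta>\<^sub>0 / \<Delta>\<^sub>0\<close>, by \<open>radius_ge\<close> at 0.\<close>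

lemma trfd_bound_ge_1:
  "1 \<le> trfd_bound CARD('n) Lh cp2 c2p L\<^sub>J \<sigma> \<alpha> \<theta> \<Delta>\<^sub>0 \<Delta>\<^sub>m\<^sub>a\<^sub>x (gap 0) \<epsilon>"
proof -
  have "0 \<le> (L\<^sub>J / \<sigma> + 1) * \<beta> / (\<alpha> * \<theta>) * inverse \<epsilon>"
    using beta_nonneg L_nonneg parameters by simp
  moreover have "0 \<le> log 2 (4 * Lh * max \<sigma> L\<^sub>J * cp2 * c2p\<^sup>2 * \<Delta>\<^sub>0 / ((1 - \<alpha>) * \<theta>) * inverse \<epsilon>)"
  proof -
    have "0 < (1 - \<alpha>) * \<theta> * \<epsilon>" using parameters by simp
    then have "1 \<le> 4 * max \<sigma> L\<^sub>J * H * c2p * \<Delta>\<^sub>0 / ((1 - \<alpha>) * \<theta> * \<epsilon>)"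
      using radius_ge[of 0] by (simp add: pos_le_divide_eq initial)
    also have "\<dots> = 4 * Lh * max \<sigma> L\<^sub>J * cp2 * c2p\<^sup>2 * \<Delta>\<^sub>0 / ((1 - \<alpha>) * \<theta>) * inverse \<epsilon>"
      by (simp add: power2_eq_square divide_inverse mult_ac)
    finally show ?thesis by simp
  qed
  moreover have "0 \<le> real_of_int \<lceil>\<bar>log 2 (4 * max \<sigma> L\<^sub>J * c2p / (\<sigma> * (1 - \<alpha>) * \<theta>))\<bar>\<rceil>"
    by (smt (verit) le_of_int_ceiling)
  ultimately have "1 * 1 \<le> trfd_bound CARD('n) Lh cp2 c2p L\<^sub>J \<sigma> \<alpha> \<theta> \<Delta>\<^sub>0 \<Delta>\<^sub>m\<^sub>a\<^sub>x (gap 0) \<epsilon>"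
    unfolding trfd_bound_def by (intro mult_mono) auto
  then show ?thesis by simp
qed

text \<open>Without an accurate iterate, \<open>iterations_bounded\<close> would bound every index
  \<open>j\<close>. \<open>K\<close> is the first accurate index, and the bound is applied to its
  predecessor.\<close>

theorem evaluations_bounded:
  "\<exists>K. gap K \<le> \<Delta>\<^sub>m\<^sub>a\<^sub>x * \<epsilon> \<and> (\<forall>k<K. \<Delta>\<^sub>m\<^sub>a\<^sub>x * \<epsilon> < gap k) \<and>
     real (evals_before p \<Omega> h F \<epsilon> \<Delta>\<^sub>m\<^sub>a\<^sub>x T K)
       \<le> trfd_bound CARD('n) Lh cp2 c2p L\<^sub>J \<sigma> \<alpha> \<theta> \<Delta>\<^sub>0 \<Delta>\<^sub>m\<^sub>a\<^sub>x (gap 0) \<epsilon> \<and>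
     (real CARD('n) + 1) * real K
       \<le> trfd_bound CARD('n) Lh cp2 c2p L\<^sub>J \<sigma> \<alpha> \<theta> \<Delta>\<^sub>0 \<Delta>\<^sub>m\<^sub>a\<^sub>x (gap 0) \<epsilon>"
proof -
  let ?B = "trfd_bound CARD('n) Lh cp2 c2p L\<^sub>J \<sigma> \<alpha> \<theta> \<Delta>\<^sub>0 \<Delta>\<^sub>m\<^sub>a\<^sub>x (gap 0) \<epsilon>"
  have "\<exists>k. gap k \<le> \<Delta>\<^sub>m\<^sub>a\<^sub>x * \<epsilon>"
  proof (rule ccontr)
    assume none: "\<not> ?thesis"
    obtain j :: nat where j: "?B < real j" using reals_Archimedean2 by blast
    have "1 * real j \<le> (real CARD('n) + 1) * (real j + 2)"
      by (intro mult_mono) auto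
    also have "\<dots> \<le> ?B"
      using none by (intro iterations_bounded) (auto simp: not_le)
    finally show False using j by simp
  qed
  then obtain K where K: "gap K \<le> \<Delta>\<^sub>m\<^sub>a\<^sub>x * \<epsilon>" "\<forall>k<K. \<Delta>\<^sub>m\<^sub>a\<^sub>x * \<epsilon> < gap k"
    using exists_least_iff[of "\<lambda>k. gap k \<le> \<Delta>\<^sub>m\<^sub>a\<^sub>x * \<epsilon>"] by (auto simp: not_le)
  have evals: "real (evals_before p \<Omega> h F \<epsilon> \<Delta>\<^sub>m\<^sub>a\<^sub>x T K) \<le> 1 + (real CARD('n) + 1) * real K"
  proof -
    have "(\<Sum>k<K. iteration_evals p \<Omega> h F \<epsilon> \<Delta>\<^sub>m\<^sub>a\<^sub>x (T k)) \<le> (\<Sum>k<K. CARD('n) + 1)"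
      by (intro sum_mono) (auto simp: iteration_evals_def)
    also have "\<dots> = K * (CARD('n) + 1)" by simp
    finally have "evals_before p \<Omega> h F \<epsilon> \<Delta>\<^sub>m\<^sub>a\<^sub>x T K \<le> 1 + (CARD('n) + 1) * K"
      unfolding evals_before_def by (simp only: mult.commute add_le_cancel_left)
    then have "real (evals_before p \<Omega> h F \<epsilon> \<Delta>\<^sub>m\<^sub>a\<^sub>x T K) \<le> real (1 + (CARD('n) + 1) * K)"
      by (simp only: of_nat_le_iff)
    then show ?thesis by (simp add: algebra_simps)
  qed
  have "1 + (real CARD('n) + 1) * real K \<le> ?B"
  proof (cases K)
    case 0
    then show ?thesis using trfd_bound_ge_1 by simp
  next
    \<comment> \<open>Here \<open>K = j + 1\<close>, so \<open>j + 2\<close> leaves a surplus of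
      \<open>n + 1\<close>, which covers the evaluation at the starting point.\<close>
    case (Suc j)
    have "(real CARD('n) + 1) * (real j + 2) \<le> ?B"
      using K Suc by (intro iterations_bounded) auto
    then show ?thesis using Suc by (simp add: algebra_simps)
  qed
  then show ?thesis using K evals by (intro exI[of _ K]) auto
qed

end

section \<open>The order of the bound\<close>

text \<open>Absorbs the logarithms into terms linear in the reciprocal accuracy. The tangent bound
  at \<open>x / 2\<close> gives \<open>ln x \<le> x / 2\<close>, and
  \<open>ln 2 \<ge> 1 / 2\<close>.\<close>

lemma log2_le_self:
  fixes x :: real
  assumes "0 < x"
  shows "log 2 x \<le> x"
proof -
  have "ln x = ln (x / 2) + ln 2" using assms by (simp add: ln_div)
  also have "ln (x / 2) \<le> x / 2 - 1" using assms by (intro ln_le_minus_one) auto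
  also have "ln (2 :: real) \<le> 1" using ln_le_minus_one[of "2 :: real"] by simp
  also have "x / 2 - 1 + 1 \<le> x * ln 2"
    using assms ln2_ge_two_thirds mult_left_mono[of "1 / 2" "ln 2" x] by simp
  finally show ?thesis by (simp add: log_def pos_divide_le_eq)
qed

text \<open>Every summand is compared with \<open>W\<close>, the leading term without
  \<open>n\<close> and numerical factors. The range conditions give \<open>1 \<le> W\<close>, so
  constants are absorbed as well; \<open>n + 1 \<le> 2 * n\<close> turns 30 into 60.\<close>

lemma trfd_bound_le_leading:
  fixes n :: nat
  assumes n: "1 \<le> n" and constants: "1 \<le> Lh" "1 \<le> cp2" "1 \<le> c2p"
    and parameters: "0 < \<sigma>" "0 < \<alpha>" "\<alpha> < 1" "0 < \<theta>" "\<theta> \<le> 1"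
    and radii: "0 < \<Delta>\<^sub>0" "\<Delta>\<^sub>0 \<le> \<Delta>\<^sub>m\<^sub>a\<^sub>x" and "0 < \<epsilon>\<^sub>f"
    and range: "leading_range \<kappa> Lh cp2 c2p L\<^sub>J \<sigma> \<Delta>\<^sub>0 \<Delta>\<^sub>m\<^sub>a\<^sub>x gap \<epsilon>\<^sub>f"
  shows "trfd_bound n Lh cp2 c2p L\<^sub>J \<sigma> \<alpha> \<theta> \<Delta>\<^sub>0 \<Delta>\<^sub>m\<^sub>a\<^sub>x gap (\<epsilon>\<^sub>f / \<Delta>\<^sub>m\<^sub>a\<^sub>x)
    \<le> bigO_const \<kappa> \<alpha> \<theta> * (real n * (Lh * cp2 * c2p\<^sup>2) * L\<^sub>J * \<Delta>\<^sub>m\<^sub>a\<^sub>x\<^sup>2 / \<epsilon>\<^sub>f)"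
proof -
  have \<kappa>: "1 \<le> \<kappa>" "L\<^sub>J \<le> \<kappa> * \<sigma>" "\<sigma> \<le> \<kappa> * L\<^sub>J"
    "gap / \<Delta>\<^sub>0 \<le> \<kappa> * (\<Delta>\<^sub>m\<^sub>a\<^sub>x * Lh * L\<^sub>J * cp2 * c2p\<^sup>2)" "\<epsilon>\<^sub>f \<le> \<kappa> * (L\<^sub>J * \<Delta>\<^sub>m\<^sub>a\<^sub>x\<^sup>2)"
    using range by (auto simp: leading_range_def)
  define q P M Q W where "q = (1 - \<alpha>) * \<theta>" and "P = Lh * cp2 * c2p\<^sup>2"
    and "M = P * L\<^sub>J * \<Delta>\<^sub>m\<^sub>a\<^sub>x\<^sup>2 / \<epsilon>\<^sub>f" and "Q = 1 / (\<alpha> * \<theta> * q)" and "W = \<kappa>\<^sup>2 * Q * M"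
  have q: "0 < q" "q \<le> 1" using parameters by (auto simp: q_def intro: mult_le_one)
  have \<alpha>\<theta>: "0 < \<alpha> * \<theta>" "\<alpha> * \<theta> \<le> 1" using parameters by (auto intro: mult_le_one)
  have \<Delta>: "0 < \<Delta>\<^sub>m\<^sub>a\<^sub>x" using radii by linarith
  \<comment> \<open>Positivity is forced by \<open>\<sigma> \<le> \<kappa> * L\<^sub>J\<close> and
    \<open>0 < \<sigma>\<close>.\<close>
  have L: "0 < L\<^sub>J" using \<kappa> parameters by (smt (verit) mult_nonneg_nonpos)
  have Q: "1 \<le> 1 / q" "1 / q \<le> Q" "1 \<le> Q"
  proof -
    show "1 \<le> 1 / q" using q by simp
    show "1 / q \<le> Q"
      unfolding Q_def using q \<alpha>\<theta> mult_left_le_one_le[of q "\<alpha> * \<theta>"]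
      by (intro frac_le) auto
    then show "1 \<le> Q" using \<open>1 \<le> 1 / q\<close> by linarith
  qed
  have c2p: "1 \<le> c2p\<^sup>2" "c2p \<le> c2p\<^sup>2"
    using constants one_le_power[of c2p 2] self_le_power[of c2p 2] by auto
  have "1 * 1 * c2p\<^sup>2 \<le> P"
    unfolding P_def using constants by (intro mult_mono) auto
  then have P: "c2p\<^sup>2 \<le> P" "1 \<le> P" using c2p by linarith+
  \<comment> \<open>The limit on \<open>\<epsilon>\<^sub>f\<close> enters here. Keeping
    \<open>c2p\<^sup>2\<close> on the left lets \<open>M\<close> absorb the factor
    \<open>c2p\<close> in the first logarithm.\<close>
  have M: "c2p\<^sup>2 \<le> \<kappa> * M"
  proof -
    have "c2p\<^sup>2 \<le> P * 1" using P by simp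
    also have "\<dots> \<le> P * (\<kappa> * (L\<^sub>J * \<Delta>\<^sub>m\<^sub>a\<^sub>x\<^sup>2) / \<epsilon>\<^sub>f)"
      using \<kappa>(5) \<open>0 < \<epsilon>\<^sub>f\<close> P by (intro mult_left_mono) auto
    finally show ?thesis by (simp add: M_def mult_ac)
  qed
  have M_pos: "0 < M" using P L \<Delta> \<open>0 < \<epsilon>\<^sub>f\<close> by (simp add: M_def)
  have \<kappa>MQ: "\<kappa> * M * Q \<le> W"
    using \<kappa>(1) M_pos Q by (simp add: W_def power2_eq_square)
  have W_ge_1: "1 \<le> W"
  proof -
    have "1 * 1 \<le> \<kappa> * M * Q" using M c2p Q by (intro mult_mono) auto
    then show ?thesis using \<kappa>MQ by linarith
  qed
  have max_\<sigma>: "max \<sigma> L\<^sub>J \<le> \<kappa> * \<sigma>" and max_L: "max \<sigma> L\<^sub>J \<le> \<kappa> * L\<^sub>J"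
    using \<kappa> L parameters by auto

  let ?A = "4 * max \<sigma> L\<^sub>J * c2p / (\<sigma> * (1 - \<alpha>) * \<theta>)"
  let ?B = "4 * Lh * max \<sigma> L\<^sub>J * cp2 * c2p\<^sup>2 * \<Delta>\<^sub>0 / ((1 - \<alpha>) * \<theta>) * inverse (\<epsilon>\<^sub>f / \<Delta>\<^sub>m\<^sub>a\<^sub>x)"
  let ?\<beta> = "beta Lh cp2 c2p L\<^sub>J \<sigma> \<alpha> \<theta> \<Delta>\<^sub>0 \<Delta>\<^sub>m\<^sub>a\<^sub>x gap"
  let ?C = "(L\<^sub>J / \<sigma> + 1) * ?\<beta> / (\<alpha> * \<theta>) * inverse (\<epsilon>\<^sub>f / \<Delta>\<^sub>m\<^sub>a\<^sub>x)"
  have "?A = 4 * (max \<sigma> L\<^sub>J / \<sigma>) * c2p * (1 / q)" by (simp add: q_def)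
  also have "\<dots> \<le> 4 * \<kappa> * (\<kappa> * M) * Q"
    using max_\<sigma> c2p M Q(2) q constants parameters \<kappa>(1)
    by (intro mult_mono) (auto simp: pos_divide_le_eq)
  also have "\<dots> = 4 * W" by (simp add: W_def power2_eq_square)
  finally have A: "?A \<le> 4 * W" .
  have A_ge_1: "1 \<le> ?A"
  proof -
    have "1 * 1 * 1 * 1 \<le> 4 * (max \<sigma> L\<^sub>J / \<sigma>) * c2p * (1 / q)"
      using constants parameters Q(1) by (intro mult_mono) (auto simp: pos_le_divide_eq)
    then show ?thesis by (simp add: q_def)
  qed
  have "?B = 4 * P * \<Delta>\<^sub>m\<^sub>a\<^sub>x / \<epsilon>\<^sub>f * max \<sigma> L\<^sub>J * \<Delta>\<^sub>0 * (1 / q)"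
    by (simp add: q_def P_def mult_ac)
  also have "\<dots> \<le> 4 * P * \<Delta>\<^sub>m\<^sub>a\<^sub>x / \<epsilon>\<^sub>f * (\<kappa> * L\<^sub>J) * \<Delta>\<^sub>m\<^sub>a\<^sub>x * Q"
    using max_L radii Q(2) q P \<Delta> \<open>0 < \<epsilon>\<^sub>f\<close> L \<kappa>(1) parameters
    by (intro mult_mono) auto
  also have "\<dots> = 4 * (\<kappa> * M * Q)" by (simp add: M_def power2_eq_square)
  also have "\<dots> \<le> 4 * W" using \<kappa>MQ by simp
  finally have B: "?B \<le> 4 * W" .
  have B_pos: "0 < ?B"
    using constants parameters radii \<Delta> \<open>0 < \<epsilon>\<^sub>f\<close> by simp
  have ratio: "L\<^sub>J / \<sigma> + 1 \<le> 2 * \<kappa>" "0 \<le> L\<^sub>J / \<sigma> + 1"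
  proof -
    have "L\<^sub>J / \<sigma> \<le> \<kappa>" using \<kappa>(2) parameters by (simp add: pos_divide_le_eq)
    then show "L\<^sub>J / \<sigma> + 1 \<le> 2 * \<kappa>" using \<kappa>(1) by linarith
    show "0 \<le> L\<^sub>J / \<sigma> + 1" using L parameters by simp
  qed
  \<comment> \<open>The 4 comes from the second term of the maximum: its own factor 2 times the 2 in
    \<open>ratio\<close>. The first term needs only \<open>\<kappa>\<close>.\<close>
  have \<beta>: "?\<beta> \<le> 4 * \<kappa> * (\<Delta>\<^sub>m\<^sub>a\<^sub>x * P * L\<^sub>J) * (1 / q)"
  proof -
    have "gap / \<Delta>\<^sub>0 \<le> 1 * \<kappa> * (\<Delta>\<^sub>m\<^sub>a\<^sub>x * P * L\<^sub>J) * 1"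
      using \<kappa>(4) by (simp add: P_def mult_ac)
    also have "\<dots> \<le> 4 * \<kappa> * (\<Delta>\<^sub>m\<^sub>a\<^sub>x * P * L\<^sub>J) * (1 / q)"
      using \<kappa>(1) Q(1) \<Delta> P L by (intro mult_mono) auto
    finally have first: "gap / \<Delta>\<^sub>0 \<le> 4 * \<kappa> * (\<Delta>\<^sub>m\<^sub>a\<^sub>x * P * L\<^sub>J) * (1 / q)" .
    have "2 * (L\<^sub>J / \<sigma> + 1) * \<Delta>\<^sub>m\<^sub>a\<^sub>x * Lh * L\<^sub>J * cp2 * c2p\<^sup>2 / ((1 - \<alpha>) * \<theta>)
        = 2 * ((L\<^sub>J / \<sigma> + 1) * ((\<Delta>\<^sub>m\<^sub>a\<^sub>x * P * L\<^sub>J) * (1 / q)))"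
      by (simp add: P_def q_def)
    also have "\<dots> \<le> 2 * ((2 * \<kappa>) * ((\<Delta>\<^sub>m\<^sub>a\<^sub>x * P * L\<^sub>J) * (1 / q)))"
      using ratio(1) \<Delta> P L q by (intro mult_left_mono mult_right_mono) auto
    finally show ?thesis using first by (simp add: beta_def)
  qed
  have "?C = ((L\<^sub>J / \<sigma> + 1) * ?\<beta>) * (\<Delta>\<^sub>m\<^sub>a\<^sub>x / (\<alpha> * \<theta> * \<epsilon>\<^sub>f))" by simp
  also have "\<dots> \<le> ((2 * \<kappa>) * (4 * \<kappa> * (\<Delta>\<^sub>m\<^sub>a\<^sub>x * P * L\<^sub>J) * (1 / q))) * (\<Delta>\<^sub>m\<^sub>a\<^sub>x / (\<alpha> * \<theta> * \<epsilon>\<^sub>f))"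
  proof (rule mult_right_mono)
    have "(L\<^sub>J / \<sigma> + 1) * ?\<beta> \<le> (L\<^sub>J / \<sigma> + 1) * (4 * \<kappa> * (\<Delta>\<^sub>m\<^sub>a\<^sub>x * P * L\<^sub>J) * (1 / q))"
      using \<beta> ratio(2) by (rule mult_left_mono)
    also have "\<dots> \<le> (2 * \<kappa>) * (4 * \<kappa> * (\<Delta>\<^sub>m\<^sub>a\<^sub>x * P * L\<^sub>J) * (1 / q))"
      using ratio(1) \<kappa>(1) \<Delta> P L q by (intro mult_right_mono) auto
    finally show "(L\<^sub>J / \<sigma> + 1) * ?\<beta> \<le> (2 * \<kappa>) * (4 * \<kappa> * (\<Delta>\<^sub>m\<^sub>a\<^sub>x * P * L\<^sub>J) * (1 / q))" .
    show "0 \<le> \<Delta>\<^sub>m\<^sub>a\<^sub>x / (\<alpha> * \<theta> * \<epsilon>\<^sub>f)" using \<Delta> parameters \<open>0 < \<epsilon>\<^sub>f\<close> by simp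
  qed
  also have "\<dots> = 8 * W"
    by (simp add: W_def M_def Q_def power2_eq_square mult_ac)
  finally have C: "?C \<le> 8 * W" .
  \<comment> \<open>The sum is at most 27 times \<open>W\<close>: 2 and 16 from the first summand, 4
    and 1 from the rounded logarithm, 4 from the other.\<close>
  have collect: "2 * (1 + c) + real_of_int \<lceil>\<bar>a\<bar>\<rceil> + b \<le> 30 * W"
    if "0 \<le> a" "a \<le> 4 * W" "b \<le> 4 * W" "c \<le> 8 * W" for a b c :: real
  proof -
    define z where "z = real_of_int \<lceil>\<bar>a\<bar>\<rceil>"
    have "z \<le> \<bar>a\<bar> + 1" unfolding z_def by (rule of_int_ceiling_le_add_one)
    then have "2 * (1 + c) + z + b \<le> 30 * W" using that W_ge_1 by argo
    then show ?thesis by (simp only: z_def)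
  qed
  have "log 2 ?A \<le> 4 * W" "log 2 ?B \<le> 4 * W"
    using log2_le_self[of ?A] log2_le_self[of ?B] A B A_ge_1 B_pos by linarith+
  moreover have "0 \<le> log 2 ?A" using A_ge_1 by simp
  ultimately have "2 * (1 + ?C) + real_of_int \<lceil>\<bar>log 2 ?A\<bar>\<rceil> + log 2 ?B \<le> 30 * W"
    using C by (intro collect)
  then have "trfd_bound n Lh cp2 c2p L\<^sub>J \<sigma> \<alpha> \<theta> \<Delta>\<^sub>0 \<Delta>\<^sub>m\<^sub>a\<^sub>x gap (\<epsilon>\<^sub>f / \<Delta>\<^sub>m\<^sub>a\<^sub>x) \<le> (real n + 1) * (30 * W)"
    unfolding trfd_bound_def by (intro mult_left_mono) auto
  also have "\<dots> \<le> (2 * real n) * (30 * W)"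
    using n W_ge_1 by (intro mult_right_mono) auto
  also have "\<dots> = bigO_const \<kappa> \<alpha> \<theta> * (real n * P * L\<^sub>J * \<Delta>\<^sub>m\<^sub>a\<^sub>x\<^sup>2 / \<epsilon>\<^sub>f)"
    by (simp add: W_def M_def Q_def q_def bigO_const_def power2_eq_square mult_ac)
  finally show ?thesis by (simp only: P_def)
qed

text \<open>Since \<open>\<epsilon>\<^sub>f \<le> E\<close>, a constant is at most \<open>E\<close>
  times itself over \<open>\<epsilon>\<^sub>f\<close>, and the logarithm is at most its argument.
  All terms then share the denominator \<open>\<epsilon>\<^sub>f\<close>.\<close>

lemma trfd_bound_le_fixed:
  fixes n :: nat
  assumes n: "1 \<le> n" and cp2: "1 \<le> cp2" and L: "0 \<le> L\<^sub>J"
    and parameters: "0 < \<sigma>" "0 < \<alpha>" "\<alpha> < 1" "0 < \<theta>"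
    and radii: "0 < \<Delta>\<^sub>0" "0 < \<Delta>\<^sub>m\<^sub>a\<^sub>x" and \<epsilon>\<^sub>f: "0 < \<epsilon>\<^sub>f" "\<epsilon>\<^sub>f \<le> E"
  shows "trfd_bound n 1 cp2 1 L\<^sub>J \<sigma> \<alpha> \<theta> \<Delta>\<^sub>0 \<Delta>\<^sub>m\<^sub>a\<^sub>x gap (\<epsilon>\<^sub>f / \<Delta>\<^sub>m\<^sub>a\<^sub>x)
    \<le> bigO_const_fixed cp2 L\<^sub>J \<sigma> \<alpha> \<theta> \<Delta>\<^sub>0 \<Delta>\<^sub>m\<^sub>a\<^sub>x gap E * (real n / \<epsilon>\<^sub>f)"
proof -
  define c where "c = real_of_int \<lceil>\<bar>log 2 (4 * max \<sigma> L\<^sub>J / (\<sigma> * (1 - \<alpha>) * \<theta>))\<bar>\<rceil>"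
  define u where "u = (L\<^sub>J / \<sigma> + 1) * beta 1 cp2 1 L\<^sub>J \<sigma> \<alpha> \<theta> \<Delta>\<^sub>0 \<Delta>\<^sub>m\<^sub>a\<^sub>x gap * \<Delta>\<^sub>m\<^sub>a\<^sub>x / (\<alpha> * \<theta>)"
  define v where "v = 4 * max \<sigma> L\<^sub>J * cp2 * \<Delta>\<^sub>0 * \<Delta>\<^sub>m\<^sub>a\<^sub>x / ((1 - \<alpha>) * \<theta>)"
  have c: "0 \<le> c" unfolding c_def by (smt (verit) le_of_int_ceiling)
  \<comment> \<open>This is the second term of the maximum in \<open>beta\<close>; its sign
    suffices, whatever \<open>gap\<close> is.\<close>
  have "0 \<le> 2 * (L\<^sub>J / \<sigma> + 1) * \<Delta>\<^sub>m\<^sub>a\<^sub>x * 1 * L\<^sub>J * cp2 * 1\<^sup>2 / ((1 - \<alpha>) * \<theta>)"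
    using L cp2 parameters radii by (intro divide_nonneg_pos mult_nonneg_nonneg) auto
  then have "0 \<le> beta 1 cp2 1 L\<^sub>J \<sigma> \<alpha> \<theta> \<Delta>\<^sub>0 \<Delta>\<^sub>m\<^sub>a\<^sub>x gap"
    unfolding beta_def by (rule max.coboundedI2)
  then have u: "0 \<le> u" using L parameters radii by (simp add: u_def)
  have v: "0 < v" using cp2 parameters radii by (simp add: v_def)
  have "log 2 (v / \<epsilon>\<^sub>f) \<le> v / \<epsilon>\<^sub>f" using v \<epsilon>\<^sub>f by (intro log2_le_self) auto
  moreover have "2 + c \<le> E * (2 + c) / \<epsilon>\<^sub>f"
    using \<epsilon>\<^sub>f c by (subst pos_le_divide_eq) (auto simp: mult.commute intro!: mult_right_mono)
  ultimately have "2 * (1 + u / \<epsilon>\<^sub>f) + c + log 2 (v / \<epsilon>\<^sub>f) \<le> (E * (2 + c) + 2 * u + v) / \<epsilon>\<^sub>f"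
    by (simp add: add_divide_distrib)
  moreover have "trfd_bound n 1 cp2 1 L\<^sub>J \<sigma> \<alpha> \<theta> \<Delta>\<^sub>0 \<Delta>\<^sub>m\<^sub>a\<^sub>x gap (\<epsilon>\<^sub>f / \<Delta>\<^sub>m\<^sub>a\<^sub>x)
      = (real n + 1) * (2 * (1 + u / \<epsilon>\<^sub>f) + c + log 2 (v / \<epsilon>\<^sub>f))"
    by (simp add: trfd_bound_def c_def u_def v_def)
  ultimately have "trfd_bound n 1 cp2 1 L\<^sub>J \<sigma> \<alpha> \<theta> \<Delta>\<^sub>0 \<Delta>\<^sub>m\<^sub>a\<^sub>x gap (\<epsilon>\<^sub>f / \<Delta>\<^sub>m\<^sub>a\<^sub>x)
      \<le> (real n + 1) * ((E * (2 + c) + 2 * u + v) / \<epsilon>\<^sub>f)"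
    by (metis mult_left_mono of_nat_0_le_iff add_nonneg_nonneg zero_le_one)
  also have "\<dots> \<le> (2 * real n) * ((E * (2 + c) + 2 * u + v) / \<epsilon>\<^sub>f)"
    using n c u v \<epsilon>\<^sub>f by (intro mult_right_mono divide_nonneg_pos add_nonneg_nonneg mult_nonneg_nonneg) auto
  also have "\<dots> = bigO_const_fixed cp2 L\<^sub>J \<sigma> \<alpha> \<theta> \<Delta>\<^sub>0 \<Delta>\<^sub>m\<^sub>a\<^sub>x gap E * (real n / \<epsilon>\<^sub>f)"
    by (simp add: bigO_const_fixed_def c_def u_def v_def)
  finally show ?thesis .
qed

section \<open>Complexity for the Minimax problem in the three norms\<close>

theorem mainTheorem4:
  fixes \<Omega> :: "(real ^ 'n) set" and F :: "real ^ 'n \<Rightarrow> real ^ 'm" and f :: "real ^ 'n \<Rightarrow> real"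
    and x\<^sub>0 x\<^sub>s :: "real ^ 'n" and T :: "nat \<Rightarrow> ('n, 'm) iterate"
    and p :: ereal
    and Lh cp2 c2p L\<^sub>J f\<^sub>l\<^sub>o\<^sub>w \<epsilon> \<epsilon>\<^sub>f \<sigma> \<alpha> \<theta> \<Delta>\<^sub>0 \<Delta>\<^sub>m\<^sub>a\<^sub>x :: real
  assumes f: "\<And>x. f x = vmax (F x)"
    and Omega: "\<Omega> \<noteq> {}" "closed \<Omega>" "convex \<Omega>"
    and diff: "\<And>x. F differentiable (at x)"
    and lipschitz: "\<And>x y. onorm ((*v) (jacobian F (at x) - jacobian F (at y))) \<le> L\<^sub>J * norm (x - y)"
    and convex: "\<And>i. convex_on UNIV (\<lambda>x. F x $ i)"
    and bounded_below: "\<And>x. f\<^sub>l\<^sub>o\<^sub>w \<le> f x"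
    and minimizer: "x\<^sub>s \<in> \<Omega>" "\<And>x. x \<in> \<Omega> \<Longrightarrow> f x\<^sub>s \<le> f x"
    and level_set: "bdd_above ((\<lambda>x. pnorm p (x - x\<^sub>s)) ` {x \<in> \<Omega>. f x \<le> f x\<^sub>0})"
    and radius: "(SUP x \<in> {x \<in> \<Omega>. f x \<le> f x\<^sub>0}. pnorm p (x - x\<^sub>s)) \<le> \<Delta>\<^sub>m\<^sub>a\<^sub>x"
    and accuracy: "0 < \<epsilon>\<^sub>f" "\<epsilon> = \<epsilon>\<^sub>f / \<Delta>\<^sub>m\<^sub>a\<^sub>x"
    and norm_case:
      "p = 1 \<and> Lh = 1 \<and> cp2 = sqrt (real CARD('m)) \<and> c2p = 1 \<or>
       p = 2 \<and> Lh = 1 \<and> cp2 = 1 \<and> c2p = 1 \<or>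
       p = \<infinity> \<and> Lh = 1 \<and> cp2 = 1 \<and> c2p = sqrt (real CARD('n))"
    and run: "trfd_run p Lh cp2 c2p \<Omega> vmax F x\<^sub>0 \<epsilon> \<sigma> \<alpha> \<theta> \<Delta>\<^sub>0 \<Delta>\<^sub>m\<^sub>a\<^sub>x T"
  shows "\<exists>K N B.
    f (point (T K)) - f x\<^sub>s \<le> \<epsilon>\<^sub>f \<and>
    (\<forall>k<K. f (point (T k)) - f x\<^sub>s > \<epsilon>\<^sub>f) \<and>
    N = real (evals_before p \<Omega> vmax F \<epsilon> \<Delta>\<^sub>m\<^sub>a\<^sub>x T K) \<and>
    B = trfd_bound CARD('n) Lh cp2 c2p L\<^sub>J \<sigma> \<alpha> \<theta> \<Delta>\<^sub>0 \<Delta>\<^sub>m\<^sub>a\<^sub>x (f x\<^sub>0 - f x\<^sub>s) \<epsilon> \<and>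
    N \<le> B \<and> (real CARD('n) + 1) * real K \<le> B \<and>
    (\<forall>\<kappa>. leading_range \<kappa> Lh cp2 c2p L\<^sub>J \<sigma> \<Delta>\<^sub>0 \<Delta>\<^sub>m\<^sub>a\<^sub>x (f x\<^sub>0 - f x\<^sub>s) \<epsilon>\<^sub>f \<longrightarrow>
      (p = 1 \<longrightarrow> N \<le> bigO_const \<kappa> \<alpha> \<theta> *
         (real CARD('n) * sqrt (real CARD('m)) * L\<^sub>J * \<Delta>\<^sub>m\<^sub>a\<^sub>x\<^sup>2 / \<epsilon>\<^sub>f)) \<and>
      (p = 2 \<longrightarrow> N \<le> bigO_const \<kappa> \<alpha> \<theta> *
         (real CARD('n) * L\<^sub>J * \<Delta>\<^sub>m\<^sub>a\<^sub>x\<^sup>2 / \<epsilon>\<^sub>f)) \<and>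
      (p = \<infinity> \<longrightarrow> N \<le> bigO_const \<kappa> \<alpha> \<theta> *
         ((real CARD('n))\<^sup>2 * L\<^sub>J * \<Delta>\<^sub>m\<^sub>a\<^sub>x\<^sup>2 / \<epsilon>\<^sub>f))) \<and>
    (p = 1 \<or> p = 2 \<longrightarrow> (\<forall>E. \<epsilon>\<^sub>f \<le> E \<longrightarrow>
      N \<le> bigO_const_fixed cp2 L\<^sub>J \<sigma> \<alpha> \<theta> \<Delta>\<^sub>0 \<Delta>\<^sub>m\<^sub>a\<^sub>x (f x\<^sub>0 - f x\<^sub>s) E * (real CARD('n) / \<epsilon>\<^sub>f)))"
proof -
  have p: "p = \<infinity> \<or> 0 < real_of_ereal p"
    using norm_case by auto
  have n: "1 \<le> real CARD('n)" "1 \<le> real CARD('m)"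
    by (simp_all add: Suc_le_eq)
  have norm_constants: "Lh = 1" "1 \<le> cp2" "1 \<le> c2p"
    using norm_case n by auto
  have norm_le: "norm s \<le> c2p * pnorm p s" for s :: "real ^ 'n"
    using norm_case norm_le_pnorm_1[of s] norm_eq_pnorm_2[of s] norm_le_pnorm_infinity[of s] by auto
  interpret trfd p Lh cp2 c2p \<Omega> vmax F x\<^sub>0 x\<^sub>s L\<^sub>J \<epsilon> \<sigma> \<alpha> \<theta> \<Delta>\<^sub>0 \<Delta>\<^sub>m\<^sub>a\<^sub>x T
  proof
    \<comment> \<open>The maximum has constant 1 in the Euclidean norm, and
      \<open>Lh * cp2 \<ge> 1\<close> in all three cases.\<close>
    show "\<bar>vmax z - vmax w\<bar> \<le> Lh * cp2 * norm (z - w)" for z w :: "real ^ 'm"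
      using vmax_lipschitz[of z w] mult_right_mono[OF norm_constants(2), of "norm (z - w)"] norm_constants
      by simp
    \<comment> \<open>Boundedness of the level set makes the real supremum an upper bound of each
      distance.\<close>
    show "pnorm p (x - x\<^sub>s) \<le> \<Delta>\<^sub>m\<^sub>a\<^sub>x" if "x \<in> \<Omega>" "vmax (F x) \<le> vmax (F x\<^sub>0)" for x
      using cSUP_upper[OF _ level_set, of x] that radius by (simp add: f)
  qed (use p norm_constants norm_le vmax_mono convex_on_vmax Omega diff lipschitz convex minimizer run
       in \<open>auto simp: f\<close>)
  have \<epsilon>\<^sub>f: "\<Delta>\<^sub>m\<^sub>a\<^sub>x * \<epsilon> = \<epsilon>\<^sub>f" using accuracy \<Delta>\<^sub>m\<^sub>a\<^sub>x_pos by simp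
  let ?B = "trfd_bound CARD('n) Lh cp2 c2p L\<^sub>J \<sigma> \<alpha> \<theta> \<Delta>\<^sub>0 \<Delta>\<^sub>m\<^sub>a\<^sub>x (f x\<^sub>0 - f x\<^sub>s) \<epsilon>"
  obtain K where K: "f (point (T K)) - f x\<^sub>s \<le> \<epsilon>\<^sub>f" "\<forall>k<K. f (point (T k)) - f x\<^sub>s > \<epsilon>\<^sub>f"
    and N: "real (evals_before p \<Omega> vmax F \<epsilon> \<Delta>\<^sub>m\<^sub>a\<^sub>x T K) \<le> ?B"
    and KB: "(real CARD('n) + 1) * real K \<le> ?B"
    using evaluations_bounded unfolding \<epsilon>\<^sub>f initial f by blast
  have fixed: "?B \<le> bigO_const_fixed cp2 L\<^sub>J \<sigma> \<alpha> \<theta> \<Delta>\<^sub>0 \<Delta>\<^sub>m\<^sub>a\<^sub>x (f x\<^sub>0 - f x\<^sub>s) E * (real CARD('n) / \<epsilon>\<^sub>f)"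
    if "p = 1 \<or> p = 2" "\<epsilon>\<^sub>f \<le> E" for E
  proof -
    have "c2p = 1" using that norm_case by auto
    then show ?thesis
      using that norm_constants parameters \<Delta>\<^sub>0_pos \<Delta>\<^sub>m\<^sub>a\<^sub>x_pos accuracy(1) L_nonneg
        trfd_bound_le_fixed[of "CARD('n)" cp2 L\<^sub>J \<sigma> \<alpha> \<theta> \<Delta>\<^sub>0 \<Delta>\<^sub>m\<^sub>a\<^sub>x \<epsilon>\<^sub>f E "f x\<^sub>0 - f x\<^sub>s"]
      by (simp add: accuracy(2) Suc_le_eq)
  qed
  have order: "real (evals_before p \<Omega> vmax F \<epsilon> \<Delta>\<^sub>m\<^sub>a\<^sub>x T K) \<le> bigO_const \<kappa> \<alpha> \<theta> *
      (real CARD('n) * (Lh * cp2 * c2p\<^sup>2) * L\<^sub>J * \<Delta>\<^sub>m\<^sub>a\<^sub>x\<^sup>2 / \<epsilon>\<^sub>f)"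
    if "leading_range \<kappa> Lh cp2 c2p L\<^sub>J \<sigma> \<Delta>\<^sub>0 \<Delta>\<^sub>m\<^sub>a\<^sub>x (f x\<^sub>0 - f x\<^sub>s) \<epsilon>\<^sub>f" for \<kappa>
  proof -
    have "?B \<le> bigO_const \<kappa> \<alpha> \<theta> * (real CARD('n) * (Lh * cp2 * c2p\<^sup>2) * L\<^sub>J * \<Delta>\<^sub>m\<^sub>a\<^sub>x\<^sup>2 / \<epsilon>\<^sub>f)"
      unfolding accuracy(2) using that norm_constants parameters \<Delta>\<^sub>0_pos initial(4) accuracy(1)
      by (intro trfd_bound_le_leading) (auto simp: Suc_le_eq)
    then show ?thesis using N by linarith
  qed
  \<comment> \<open>For the maximum norm, the square of \<open>c2p\<close> contributes the second
    factor \<open>n\<close>.\<close>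
  have cases: "p = 1 \<Longrightarrow> cp2 = sqrt (real CARD('m)) \<and> c2p = 1"
    "p = 2 \<Longrightarrow> cp2 = 1 \<and> c2p = 1"
    "p = \<infinity> \<Longrightarrow> cp2 = 1 \<and> c2p\<^sup>2 = real CARD('n)"
    using norm_case by auto
  show ?thesis
  proof (intro exI conjI allI impI)
    fix \<kappa>
    assume range: "leading_range \<kappa> Lh cp2 c2p L\<^sub>J \<sigma> \<Delta>\<^sub>0 \<Delta>\<^sub>m\<^sub>a\<^sub>x (f x\<^sub>0 - f x\<^sub>s) \<epsilon>\<^sub>f"
    show "real (evals_before p \<Omega> vmax F \<epsilon> \<Delta>\<^sub>m\<^sub>a\<^sub>x T K) \<le> bigO_const \<kappa> \<alpha> \<theta> *
         (real CARD('n) * sqrt (real CARD('m)) * L\<^sub>J * \<Delta>\<^sub>m\<^sub>a\<^sub>x\<^sup>2 / \<epsilon>\<^sub>f)" if "p = 1"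
      using order[OF range] cases(1)[OF that] norm_constants(1) by simp
    show "real (evals_before p \<Omega> vmax F \<epsilon> \<Delta>\<^sub>m\<^sub>a\<^sub>x T K) \<le> bigO_const \<kappa> \<alpha> \<theta> *
         (real CARD('n) * L\<^sub>J * \<Delta>\<^sub>m\<^sub>a\<^sub>x\<^sup>2 / \<epsilon>\<^sub>f)" if "p = 2"
      using order[OF range] cases(2)[OF that] norm_constants(1) by simp
    show "real (evals_before p \<Omega> vmax F \<epsilon> \<Delta>\<^sub>m\<^sub>a\<^sub>x T K) \<le> bigO_const \<kappa> \<alpha> \<theta> *
         ((real CARD('n))\<^sup>2 * L\<^sub>J * \<Delta>\<^sub>m\<^sub>a\<^sub>x\<^sup>2 / \<epsilon>\<^sub>f)" if "p = \<infinity>"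
      using order[OF range] cases(3)[OF that] norm_constants(1) by (simp add: power2_eq_square)
  next
    fix E
    assume "p = 1 \<or> p = 2" "\<epsilon>\<^sub>f \<le> E"
    then show "real (evals_before p \<Omega> vmax F \<epsilon> \<Delta>\<^sub>m\<^sub>a\<^sub>x T K)
        \<le> bigO_const_fixed cp2 L\<^sub>J \<sigma> \<alpha> \<theta> \<Delta>\<^sub>0 \<Delta>\<^sub>m\<^sub>a\<^sub>x (f x\<^sub>0 - f x\<^sub>s) E * (real CARD('n) / \<epsilon>\<^sub>f)"
      using fixed[of E] N by linarith
  qed (use K N KB in auto)
qed

end
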